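(* Let $r_1,r_2\in\mathbb N_0$ with $r_2>r_1$, and let $L_{r_1,r_2}$ be a logistic random variable with distribution function \[\mathbb P\bigl\{L_{r_1,r_2}<x\bigr\}=\frac{r_2!}{r_2!+r_1!\,\mathrm e^{-x}},\quad x\in\mathbb R.\] Then \[\frac{\Delta_{r_1,r_2}^{(n)}}n-(r_2-r_1)\ln\ln n\xrightarrow{d}L_{r_1,r_2}\quad\text{as }n\to\infty.\]
   Context: Extended coupon collector's problem. For each $n\in\mathbb N$, coupons arrive one by one at times $1,2,3,\ldots$; the types of the coupons are independent and uniformly distributed on $\{1,\ldots,n\}$. For $i\in\{1,\ldots,n\}$ and $r\in\mathbb N_0=\mathbb N\cup\{0\}$, let $Y_{i,r}^{(n)}$ be the arrival time of the $(r+1)$-th coupon of type $i$. Let $T_r^{(n)}=\max_{1\le i\le n}Y_{i,r}^{(n)}$, the time when the collector labelled $r$ completes his collection, i.e. the first time at which at least $r+1$ coupons of each type have arrived. For $r_2>r_1$, let $\Delta_{r_1,r_2}^{(n)}=T_{r_2}^{(n)}-T_{r_1}^{(n)}$. $\xrightarrow{d}$ denotes convergence in distribution. *)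

theory Defs
  imports "HOL-Probability.Probability"
begin

text \<open>
  \<open>X t\<close> is the type of the coupon arriving at time \<open>t\<close>, for \<open>t = 1, 2, 3, \<dots>\<close>;
  \<open>X 0\<close> is unconstrained and never used.
\<close>

locale coupon_process = prob_space M
  for M :: "'a measure" and n :: nat and X :: "nat \<Rightarrow> 'a \<Rightarrow> nat" +
  assumes indep_types: "indep_vars (\<lambda>_. count_space UNIV) X {1..}"
    and uniform_types: "\<And>t. 1 \<le> t \<Longrightarrow>
      distr M (count_space UNIV) (X t) = measure_pmf (pmf_of_set {1..n})"

text \<open>
  Since \<^const>\<open>enumerate\<close> counts from \<open>0\<close>, index \<open>r\<close> selects the \<open>(r + 1)\<close>-th coupon of type
  \<open>i\<close>. If type \<open>i\<close> arrives only finitely often (for \<open>1 \<le> i \<le> n\<close> an event of probability \<open>0\<close>),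
  the value for large \<open>r\<close> is an unspecified natural number rather than infinity.
\<close>

definition arrival_time :: "(nat \<Rightarrow> 'a \<Rightarrow> nat) \<Rightarrow> nat \<Rightarrow> nat \<Rightarrow> 'a \<Rightarrow> nat" where
  "arrival_time X i r \<omega> = enumerate {t. 1 \<le> t \<and> X t \<omega> = i} r"

definition completion_time :: "nat \<Rightarrow> (nat \<Rightarrow> 'a \<Rightarrow> nat) \<Rightarrow> nat \<Rightarrow> 'a \<Rightarrow> nat" where
  "completion_time n X r \<omega> = Max ((\<lambda>i. arrival_time X i r \<omega>) ` {1..n})"

definition completion_gap :: "nat \<Rightarrow> (nat \<Rightarrow> 'a \<Rightarrow> nat) \<Rightarrow> nat \<Rightarrow> nat \<Rightarrow> 'a \<Rightarrow> real" where
  "completion_gap n X r\<^sub>1 r\<^sub>2 \<omega> =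
    real (completion_time n X r\<^sub>2 \<omega>) - real (completion_time n X r\<^sub>1 \<omega>)"

end

theory Submission
  imports Defs "HOL-Real_Asymp.Real_Asymp"
begin

text \<open>
  Let \<open>T\<^sub>r\<close> be the completion time of collector \<open>r\<close>. The number of types that are still short of
  their \<open>(r + 1)\<close>-th coupon at time \<open>n (ln n + r ln ln n + x)\<close> has a mean tending to
  \<open>exp (- x) / r!\<close> and is asymptotically Poisson, so \<open>T\<^sub>r / n - ln n - r ln ln n\<close> has a Gumbel limit.
  For \<open>r\<^sub>1 < r\<^sub>2\<close> the two time windows are \<open>(r\<^sub>2 - r\<^sub>1) n ln ln n + O(n)\<close> apart, and a type that
  is late for collector \<open>r\<^sub>1\<close> has asymptotically no chance to be late for collector \<open>r\<^sub>2\<close> too.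
  Hence the two limits are independent, and their difference is logistic.

  The joint limit is obtained by Poissonization. If the numbers of draws in \<open>{1..m\<^sub>1}\<close> and in the
  following block are independent Poisson variables with means \<open>n \<alpha>\<close> and \<open>n \<beta>\<close>, then the \<open>n\<close>
  pairs of coupon counts are independent, each consisting of two independent Poisson variables with
  means \<open>\<alpha>\<close> and \<open>\<beta>\<close>. The success probability becomes an \<open>n\<close>-th power \<open>(1 - q)\<^sup>n\<close>
  (\<open>poissonization\<close>) with \<open>n q\<close> convergent (\<open>poissonized_limit\<close>). In this development the
  independence is a statement about exponential generating functions: the number of words over
  \<open>n\<close> letters in which every letter satisfies a condition on its two block counts has as its
  generating function the \<open>n\<close>-th power of the one for a single letter. The success probability is monotone in both block lengths, and a Poisson variable of
  mean \<open>O(n ln n)\<close> deviates from its mean by \<open>o(n)\<close>, the scale on which the limit lives;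
  so the randomness of the block lengths can be removed again (\<open>depoissonization\<close>).

  For the passage to the difference it is convenient to transform each completion time to
  \<open>A\<^sub>r = exp (ln n + r ln ln n - T\<^sub>r / n) / r!\<close>. Then the joint limit says that \<open>A\<^bsub>r\<^sub>1\<^esub>\<close> and
  \<open>A\<^bsub>r\<^sub>2\<^esub>\<close> converge to independent standard exponential variables, and the event that the
  normalised gap is at most \<open>z\<close> is exactly \<open>c A\<^bsub>r\<^sub>1\<^esub> \<le> A\<^bsub>r\<^sub>2\<^esub>\<close> with
  \<open>c = r\<^sub>1! exp (- z) / r\<^sub>2!\<close>. For independent standard exponentials this event has probability
  \<open>1 / (1 + c)\<close>, the value at \<open>z\<close> of the logistic distribution function
  (\<open>ratio_of_exponentials\<close>).
\<close>

section \<open>Words with prescribed letter counts in two blocks\<close>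

text \<open>
  The positions are split into two disjoint blocks \<open>A\<close> and \<open>B\<close>, which stand for the draws up to
  a first and between a first and a second point of time. The condition \<open>G\<close> constrains, for each
  letter, the pair of its numbers of occurrences in the two blocks.
\<close>

definition good_words :: "(nat \<Rightarrow> nat \<Rightarrow> bool) \<Rightarrow> nat \<Rightarrow> 't set \<Rightarrow> 't set \<Rightarrow> ('t \<Rightarrow> nat) set" where
  "good_words G n A B =
    {f \<in> (A \<union> B) \<rightarrow>\<^sub>E {1..n}. \<forall>i\<in>{1..n}. G (card {t\<in>A. f t = i}) (card {t\<in>B. f t = i})}"

text \<open>
  The coefficient of \<open>x\<^sup>a y\<^sup>b\<close> in the \<open>n\<close>-th power of the bivariate series
  \<open>\<Sum>i j. [G i j] x\<^sup>i y\<^sup>j / (i! j!)\<close>, computed by successive Cauchy products.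
\<close>

fun good_coeff :: "(nat \<Rightarrow> nat \<Rightarrow> bool) \<Rightarrow> nat \<Rightarrow> nat \<Rightarrow> nat \<Rightarrow> real" where
  "good_coeff G 0 a b = (if a = 0 \<and> b = 0 then 1 else 0)"
| "good_coeff G (Suc n) a b =
    (\<Sum>i\<le>a. \<Sum>j\<le>b. (if G i j then 1 / (fact i * fact j) else 0) * good_coeff G n (a - i) (b - j))"

lemma finite_good_words: "finite A \<Longrightarrow> finite B \<Longrightarrow> finite (good_words G n A B)"
  unfolding good_words_def by (rule finite_subset[of _ "(A \<union> B) \<rightarrow>\<^sub>E {1..n}"]) (auto intro!: finite_PiE)

text \<open>
  A word over \<open>n + 1\<close> letters amounts to the sets \<open>S\<close>, \<open>T\<close> of positions of the last letter in the
  two blocks, together with a word over \<open>n\<close> letters on the remaining positions.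
\<close>

lemma card_good_words_Suc:
  assumes fin: "finite A" "finite B" and disj: "A \<inter> B = {}"
  shows "card (good_words G (Suc n) A B) =
    (\<Sum>S\<in>Pow A. \<Sum>T\<in>Pow B. if G (card S) (card T) then card (good_words G n (A - S) (B - T)) else 0)"
proof -
  define P where "P = {(S, T). S \<subseteq> A \<and> T \<subseteq> B \<and> G (card S) (card T)}"
  define W where "W = (\<lambda>(S, T). good_words G n (A - S) (B - T))"
  define h where "h f = (({t\<in>A. f t = Suc n}, {t\<in>B. f t = Suc n}),
      restrict f ({t\<in>A \<union> B. f t \<noteq> Suc n}))" for f :: "'a \<Rightarrow> nat"
  \<comment> \<open>The inverse of \<open>h\<close>: the last letter is put back on \<open>S \<union> T\<close>.\<close>
  define k :: "('a set \<times> 'a set) \<times> ('a \<Rightarrow> nat) \<Rightarrow> 'a \<Rightarrow> nat" where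
    "k = (\<lambda>((S, T), g) t. if t \<in> S \<union> T then Suc n else g t)"
  have finP: "finite P"
    by (rule finite_subset[of _ "Pow A \<times> Pow B"]) (auto simp: P_def fin)
  have "bij_betw h (good_words G (Suc n) A B) (SIGMA p:P. W p)"
  proof (rule bij_betw_byWitness[where f' = k])
    show "\<forall>f\<in>good_words G (Suc n) A B. k (h f) = f"
    proof
      fix f assume f: "f \<in> good_words G (Suc n) A B"
      show "k (h f) = f"
      proof
        fix t show "k (h f) t = f t"
          using f by (auto simp: k_def h_def good_words_def PiE_def extensional_def)
      qed
    qed
  next
    show "\<forall>q\<in>Sigma P W. h (k q) = q"
    proof
      fix q assume "q \<in> Sigma P W"
      then obtain S T g where q: "q = ((S, T), g)" and ST: "S \<subseteq> A" "T \<subseteq> B"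
        and g: "g \<in> good_words G n (A - S) (B - T)" by (auto simp: P_def W_def)
      have gn: "g t \<noteq> Suc n" if "t \<in> (A - S) \<union> (B - T)" for t
        using g that PiE_mem[of g "(A - S) \<union> (B - T)" "\<lambda>_. {1..n}" t]
        by (auto simp: good_words_def)
      have gu: "g t = undefined" if "t \<notin> (A - S) \<union> (B - T)" for t
        using g that by (auto simp: good_words_def PiE_def extensional_def)
      have 1: "{t\<in>A. k q t = Suc n} = S" using gn ST disj by (auto simp: k_def q split: if_splits)
      have 2: "{t\<in>B. k q t = Suc n} = T" using gn ST disj by (auto simp: k_def q split: if_splits)
      have 3: "{t\<in>A \<union> B. k q t \<noteq> Suc n} = (A - S) \<union> (B - T)" using 1 2 ST disj by blast
      have "restrict (k q) ((A - S) \<union> (B - T)) = g"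
        using gu ST disj by (auto simp: k_def q restrict_def fun_eq_iff)
      then show "h (k q) = q" using 1 2 3 by (simp add: h_def q)
    qed
  next
    show "h ` good_words G (Suc n) A B \<subseteq> Sigma P W"
    proof (rule image_subsetI)
      fix f assume f: "f \<in> good_words G (Suc n) A B"
      let ?S = "{t\<in>A. f t = Suc n}" and ?T = "{t\<in>B. f t = Suc n}"
      let ?g = "restrict f {t\<in>A \<union> B. f t \<noteq> Suc n}"
      have fm: "f t \<in> {1..Suc n}" if "t \<in> A \<union> B" for t
        using f that by (auto simp: good_words_def PiE_def Pi_def)
      have "?g \<in> ((A - ?S) \<union> (B - ?T)) \<rightarrow>\<^sub>E {1..n}"
      proof (rule PiE_I)
        fix t assume "t \<in> (A - ?S) \<union> (B - ?T)"
        then show "?g t \<in> {1..n}" using fm[of t] by auto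
      qed (use disj in auto)
      moreover have "{t\<in>A - ?S. ?g t = i} = {t\<in>A. f t = i}"
        "{t\<in>B - ?T. ?g t = i} = {t\<in>B. f t = i}" if "i \<in> {1..n}" for i
        using that by auto
      ultimately have "?g \<in> good_words G n (A - ?S) (B - ?T)"
        using f by (auto simp: good_words_def)
      moreover have "G (card ?S) (card ?T)" using f by (auto simp: good_words_def)
      ultimately show "h f \<in> Sigma P W" by (auto simp: h_def P_def W_def)
    qed
  next
    show "k ` Sigma P W \<subseteq> good_words G (Suc n) A B"
    proof
      fix f assume "f \<in> k ` Sigma P W"
      then obtain S T g where fk: "f = k ((S, T), g)" and ST: "S \<subseteq> A" "T \<subseteq> B" "G (card S) (card T)"
        and g: "g \<in> good_words G n (A - S) (B - T)" by (auto simp: P_def W_def)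
      have gm: "g t \<in> {1..n}" if "t \<in> (A - S) \<union> (B - T)" for t
        using g that PiE_mem[of g "(A - S) \<union> (B - T)" "\<lambda>_. {1..n}" t]
        by (auto simp: good_words_def)
      have gu: "g t = undefined" if "t \<notin> (A - S) \<union> (B - T)" for t
        using g that by (auto simp: good_words_def PiE_def extensional_def)
      have "f \<in> (A \<union> B) \<rightarrow>\<^sub>E {1..Suc n}"
      proof (rule PiE_I)
        fix t assume "t \<in> A \<union> B"
        then show "f t \<in> {1..Suc n}"
          using gm[of t] by (cases "t \<in> S \<union> T") (auto simp: fk k_def)
      next
        fix t assume "t \<notin> A \<union> B"
        then show "f t = undefined"
          using gu[of t] ST by (auto simp: fk k_def)
      qed
      moreover have "G (card {t\<in>A. f t = i}) (card {t\<in>B. f t = i})" if i: "i \<in> {1..Suc n}" for i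
      proof (cases "i = Suc n")
        case True
        have "{t\<in>A. f t = i} = S" "{t\<in>B. f t = i} = T"
          using gm ST disj True by (fastforce simp: fk k_def split: if_splits)+
        then show ?thesis using ST by simp
      next
        case False
        have "{t\<in>A. f t = i} = {t\<in>A - S. g t = i}" "{t\<in>B. f t = i} = {t\<in>B - T. g t = i}"
          using False ST disj by (auto simp: fk k_def split: if_splits)
        then show ?thesis using g i False by (auto simp: good_words_def)
      qed
      ultimately show "f \<in> good_words G (Suc n) A B" by (auto simp: good_words_def)
    qed
  qed
  then have "card (good_words G (Suc n) A B) = card (SIGMA p:P. W p)"
    by (rule bij_betw_same_card)
  also have "\<dots> = (\<Sum>p\<in>P. card (W p))"
    by (rule card_SigmaI) (auto simp: finP W_def fin finite_good_words)
  also have "\<dots> = (\<Sum>p\<in>Pow A \<times> Pow B. if G (card (fst p)) (card (snd p)) then card (W p) else 0)"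
    by (rule sum.mono_neutral_cong_left) (auto simp: P_def fin)
  also have "\<dots> = (\<Sum>S\<in>Pow A. \<Sum>T\<in>Pow B. if G (card S) (card T) then card (good_words G n (A - S) (B - T)) else 0)"
    by (simp add: sum.cartesian_product W_def case_prod_beta cong: if_cong)
  finally show ?thesis .
qed

lemma sum_Pow_card:
  fixes h :: "nat \<Rightarrow> real"
  assumes "finite A"
  shows "(\<Sum>S\<in>Pow A. h (card S)) = (\<Sum>k\<le>card A. real (card A choose k) * h k)"
proof -
  have "(\<Sum>S\<in>Pow A. h (card S)) = (\<Sum>k\<le>card A. \<Sum>S\<in>{S\<in>Pow A. card S = k}. h (card S))"
    by (rule sum.group[symmetric]) (auto simp: assms card_mono)
  also have "\<dots> = (\<Sum>k\<le>card A. real (card A choose k) * h k)"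
  proof (rule sum.cong[OF refl])
    fix k
    have "(\<Sum>S\<in>{S\<in>Pow A. card S = k}. h (card S)) = real (card {S. S \<subseteq> A \<and> card S = k}) * h k"
      by simp
    then show "(\<Sum>S\<in>{S\<in>Pow A. card S = k}. h (card S)) = real (card A choose k) * h k"
      using n_subsets[OF assms] by simp
  qed
  finally show ?thesis .
qed

text \<open>
  Grouping the sets of positions by cardinality turns the recurrence into a binomial convolution,
  and division by \<open>a! b!\<close> turns this into the Cauchy product that defines \<^const>\<open>good_coeff\<close>.
\<close>

lemma card_good_words:
  assumes "finite A" "finite B" "A \<inter> B = {}"
  shows "real (card (good_words G n A B)) = fact (card A) * fact (card B) * good_coeff G n (card A) (card B)"
  using assms
proof (induction n arbitrary: A B)
  case 0
  show ?case
  proof (cases "A \<union> B = {}")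
    case True
    then have "good_words G 0 A B = {\<lambda>_. undefined}" by (auto simp: good_words_def)
    then show ?thesis using True by simp
  next
    case False
    then have "good_words G 0 A B = {}" by (auto simp: good_words_def PiE_eq_empty_iff)
    then show ?thesis using False 0 by auto
  qed
next
  case (Suc n)
  let ?a = "card A" and ?b = "card B"
  define c where "c i j = (if G i j then fact (?a - i) * fact (?b - j) * good_coeff G n (?a - i) (?b - j) else 0)" for i j
  have "real (card (good_words G (Suc n) A B)) =
      (\<Sum>S\<in>Pow A. \<Sum>T\<in>Pow B. c (card S) (card T))"
    unfolding card_good_words_Suc[OF Suc.prems] of_nat_sum
  proof (intro sum.cong refl)
    fix S T assume ST: "S \<in> Pow A" "T \<in> Pow B"
    have "real (card (good_words G n (A - S) (B - T))) =
      fact (card (A - S)) * fact (card (B - T)) * good_coeff G n (card (A - S)) (card (B - T))"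
      by (rule Suc.IH) (use Suc.prems in auto)
    moreover have "card (A - S) = ?a - card S" "card (B - T) = ?b - card T"
      using ST Suc.prems by (auto intro!: card_Diff_subset intro: finite_subset)
    ultimately show "real (if G (card S) (card T) then card (good_words G n (A - S) (B - T)) else 0) = c (card S) (card T)"
      by (simp add: c_def)
  qed
  also have "\<dots> = (\<Sum>i\<le>?a. real (?a choose i) * (\<Sum>j\<le>?b. real (?b choose j) * c i j))"
    by (simp add: sum_Pow_card[OF Suc.prems(2)] sum_Pow_card[OF Suc.prems(1), of "\<lambda>k. \<Sum>j\<le>?b. real (?b choose j) * c k j"])
  also have "\<dots> = fact ?a * fact ?b * good_coeff G (Suc n) ?a ?b"
    unfolding good_coeff.simps sum_distrib_left
    by (intro sum.cong refl) (simp add: c_def binomial_fact)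
  finally show ?case .
qed

section \<open>The exponential generating function of good words\<close>

lemma suminf_ennreal_commute:
  fixes f :: "nat \<Rightarrow> nat \<Rightarrow> ennreal"
  shows "(\<Sum>i. \<Sum>j. f i j) = (\<Sum>j. \<Sum>i. f i j)"
  using nn_integral_suminf[of "\<lambda>i j. f i j" "count_space UNIV"]
  by (simp add: nn_integral_count_space_nat)

text \<open>
  Nonnegative extended terms make the reordering of the double sum unconditional, so that no
  summability has to be tracked.
\<close>

lemma Cauchy_product_ennreal:
  fixes f g :: "nat \<Rightarrow> ennreal"
  shows "(\<Sum>m. \<Sum>a\<le>m. f a * g (m - a)) = (\<Sum>a. f a) * (\<Sum>b. g b)"
proof -
  have "(\<Sum>m. \<Sum>a\<le>m. f a * g (m - a)) = (\<Sum>m. \<Sum>a. if a \<le> m then f a * g (m - a) else 0)"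
  proof (intro suminf_cong)
    fix m
    show "(\<Sum>a\<le>m. f a * g (m - a)) = (\<Sum>a. if a \<le> m then f a * g (m - a) else 0)"
      by (subst suminf_finite[of "{..m}"]) auto
  qed
  also have "\<dots> = (\<Sum>a. \<Sum>m. if a \<le> m then f a * g (m - a) else 0)"
    by (rule suminf_ennreal_commute)
  also have "\<dots> = (\<Sum>a. f a * (\<Sum>b. g b))"
  proof (intro suminf_cong)
    fix a
    have "(\<Sum>m. if a \<le> m then f a * g (m - a) else 0) = (\<Sum>m. (if a \<le> m + a then f a * g (m + a - a) else 0)) + (\<Sum>m<a. if a \<le> m then f a * g (m - a) else 0)"
      by (rule suminf_offset) simp
    also have "\<dots> = f a * (\<Sum>b. g b)" by simp
    finally show "(\<Sum>m. if a \<le> m then f a * g (m - a) else 0) = f a * (\<Sum>b. g b)" .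
  qed
  finally show ?thesis by simp
qed

lemma Cauchy_product_ennreal2:
  fixes f g :: "nat \<Rightarrow> nat \<Rightarrow> ennreal"
  shows "(\<Sum>a. \<Sum>b. \<Sum>i\<le>a. \<Sum>j\<le>b. f i j * g (a - i) (b - j)) =
    (\<Sum>i. \<Sum>j. f i j) * (\<Sum>i. \<Sum>j. g i j)"
proof -
  have "(\<Sum>b. \<Sum>i\<le>a. \<Sum>j\<le>b. f i j * g (a - i) (b - j)) = (\<Sum>i\<le>a. (\<Sum>j. f i j) * (\<Sum>j. g (a - i) j))" for a
    by (subst suminf_sum) (simp_all add: Cauchy_product_ennreal)
  then show ?thesis
    using Cauchy_product_ennreal[of "\<lambda>i. \<Sum>j. f i j" "\<lambda>i. \<Sum>j. g i j"] by simp
qed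

lemma good_coeff_nonneg: "good_coeff G n a b \<ge> 0"
  by (induction n arbitrary: a b) (auto intro!: sum_nonneg)

lemma good_coeff_generating_function:
  fixes x y :: real
  assumes "x \<ge> 0" "y \<ge> 0"
  shows "(\<Sum>a. \<Sum>b. ennreal (x ^ a * y ^ b * good_coeff G n a b)) =
    (\<Sum>a. \<Sum>b. if G a b then ennreal (x ^ a / fact a * (y ^ b / fact b)) else 0) ^ n"
proof (induction n)
  case 0
  have "(\<Sum>b. ennreal (x ^ a * y ^ b * good_coeff G 0 a b)) = (if a = 0 then 1 else 0)" for a
    by (subst suminf_finite[of "{0}"]) auto
  moreover have "(\<Sum>a. if a = 0 then 1 else 0::ennreal) = 1" by (subst suminf_finite[of "{0::nat}"]) auto
  ultimately show ?case by (simp only: power_0)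
next
  case (Suc n)
  define f where "f a b = (if G a b then x ^ a / fact a * (y ^ b / fact b) else 0)" for a b
  define g where "g a b = x ^ a * y ^ b * good_coeff G n a b" for a b
  have nn: "f a b \<ge> 0" "g a b \<ge> 0" for a b
    using assms by (auto simp: f_def g_def good_coeff_nonneg)
  have *: "x ^ a * y ^ b * good_coeff G (Suc n) a b = (\<Sum>i\<le>a. \<Sum>j\<le>b. f i j * g (a - i) (b - j))" for a b
    unfolding good_coeff.simps sum_distrib_left
  proof (intro sum.cong refl, goal_cases)
    case (1 i j)
    then have "x ^ a = x ^ i * x ^ (a - i)" "y ^ b = y ^ j * y ^ (b - j)"
      by (simp_all flip: power_add)
    then show ?case by (simp add: f_def g_def)
  qed
  have "(\<Sum>a. \<Sum>b. ennreal (x ^ a * y ^ b * good_coeff G (Suc n) a b)) =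
     (\<Sum>a. \<Sum>b. \<Sum>i\<le>a. \<Sum>j\<le>b. ennreal (f i j) * ennreal (g (a - i) (b - j)))"
    unfolding * by (simp add: sum_nonneg nn flip: ennreal_mult sum_ennreal)
  also have "\<dots> = (\<Sum>i. \<Sum>j. ennreal (f i j)) * (\<Sum>i. \<Sum>j. ennreal (g i j))"
    by (rule Cauchy_product_ennreal2)
  also have "\<dots> = (\<Sum>a. \<Sum>b. if G a b then ennreal (x ^ a / fact a * (y ^ b / fact b)) else 0) ^ Suc n"
  proof -
    have "ennreal (f a b) = (if G a b then ennreal (x ^ a / fact a * (y ^ b / fact b)) else 0)" for a b
      by (simp add: f_def)
    moreover note Suc.IH
    ultimately show ?thesis by (simp only: g_def power_Suc)
  qed
  finally show ?case .
qed

lemma nn_integral_pmf_nat: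
  fixes p :: "nat pmf"
  shows "(\<integral>\<^sup>+a. f a \<partial>measure_pmf p) = (\<Sum>a. ennreal (pmf p a) * f a)"
  by (simp add: nn_integral_measure_pmf nn_integral_count_space_nat)

text \<open>
  Up to the normalising factor, the series of a single letter is the probability that a
  pair of independent Poisson counts is good.
\<close>

lemma good_pair_generating_function:
  assumes "\<alpha> > 0" "\<beta> > 0"
  shows "ennreal (exp (- \<alpha>) * exp (- \<beta>)) * (\<Sum>a. \<Sum>b. if G a b then ennreal (\<alpha> ^ a / fact a * (\<beta> ^ b / fact b)) else 0) =
    emeasure (pair_pmf (poisson_pmf \<alpha>) (poisson_pmf \<beta>)) {(a, b). G a b}"
proof -
  have "emeasure (pair_pmf (poisson_pmf \<alpha>) (poisson_pmf \<beta>)) {(a, b). G a b} =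
    (\<integral>\<^sup>+p. indicator {(a, b). G a b} p \<partial>pair_pmf (poisson_pmf \<alpha>) (poisson_pmf \<beta>))" by simp
  also have "\<dots> = (\<integral>\<^sup>+a. \<integral>\<^sup>+b. indicator {(a, b). G a b} (a, b) \<partial>poisson_pmf \<beta> \<partial>poisson_pmf \<alpha>)"
    by (rule nn_integral_pair_pmf')
  also have "\<dots> = (\<Sum>a. \<Sum>b. ennreal (pmf (poisson_pmf \<alpha>) a) * (ennreal (pmf (poisson_pmf \<beta>) b) * indicator {(a, b). G a b} (a, b)))"
    by (simp only: nn_integral_pmf_nat ennreal_suminf_cmult)
  also have "\<dots> = (\<Sum>a. \<Sum>b. ennreal (exp (- \<alpha>) * exp (- \<beta>)) * (if G a b then ennreal (\<alpha> ^ a / fact a * (\<beta> ^ b / fact b)) else 0))"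
  proof (intro suminf_cong)
    fix a b
    have "ennreal (pmf (poisson_pmf \<alpha>) a) * ennreal (pmf (poisson_pmf \<beta>) b) =
      ennreal (exp (- \<alpha>) * exp (- \<beta>)) * ennreal (\<alpha> ^ a / fact a * (\<beta> ^ b / fact b))"
      using assms by (simp add: ac_simps flip: ennreal_mult)
    then show "ennreal (pmf (poisson_pmf \<alpha>) a) * (ennreal (pmf (poisson_pmf \<beta>) b) * indicator {(a, b). G a b} (a, b)) =
      ennreal (exp (- \<alpha>) * exp (- \<beta>)) * (if G a b then ennreal (\<alpha> ^ a / fact a * (\<beta> ^ b / fact b)) else 0)"
      by (cases "G a b") simp_all
  qed
  also have "\<dots> = ennreal (exp (- \<alpha>) * exp (- \<beta>)) * (\<Sum>a. \<Sum>b. if G a b then ennreal (\<alpha> ^ a / fact a * (\<beta> ^ b / fact b)) else 0)"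
    by (simp only: ennreal_suminf_cmult)
  finally show ?thesis by simp
qed

text \<open>
  The probability of a good word with block lengths \<open>a\<close> and \<open>b\<close>, averaged over independent
  Poisson lengths of means \<open>n \<alpha>\<close> and \<open>n \<beta>\<close>, factorises over the letters: the factorials and
  the powers of \<open>n\<close> cancel against the Poisson weights, which leaves the generating function of
  \<^const>\<open>good_coeff\<close> at \<open>(\<alpha>, \<beta>)\<close>.
\<close>

lemma poissonization:
  fixes n :: nat
  assumes pos: "\<alpha> > 0" "\<beta> > 0" and n: "1 \<le> n"
  shows "(\<integral>\<^sup>+a. \<integral>\<^sup>+b. ennreal (fact a * fact b * good_coeff G n a b / real n ^ (a + b))
      \<partial>poisson_pmf (real n * \<beta>) \<partial>poisson_pmf (real n * \<alpha>)) =
    ennreal (measure_pmf.prob (pair_pmf (poisson_pmf \<alpha>) (poisson_pmf \<beta>)) {(a, b). G a b} ^ n)"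
proof -
  let ?c = "exp (- \<alpha>) * exp (- \<beta>)"
  have np: "real n * \<alpha> > 0" "real n * \<beta> > 0" using assms by auto
  have "(\<integral>\<^sup>+a. \<integral>\<^sup>+b. ennreal (fact a * fact b * good_coeff G n a b / real n ^ (a + b))
      \<partial>poisson_pmf (real n * \<beta>) \<partial>poisson_pmf (real n * \<alpha>)) =
    (\<Sum>a. \<Sum>b. ennreal (pmf (poisson_pmf (real n * \<alpha>)) a) * (ennreal (pmf (poisson_pmf (real n * \<beta>)) b) *
       ennreal (fact a * fact b * good_coeff G n a b / real n ^ (a + b))))"
    by (simp only: nn_integral_pmf_nat ennreal_suminf_cmult)
  also have "\<dots> = (\<Sum>a. \<Sum>b. ennreal (?c ^ n) * ennreal (\<alpha> ^ a * \<beta> ^ b * good_coeff G n a b))"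
  proof (intro suminf_cong)
    fix a b
    have e: "exp (- (real n * \<alpha>)) * exp (- (real n * \<beta>)) = ?c ^ n"
      by (simp add: power_mult_distrib flip: exp_of_nat_mult)
    have "pmf (poisson_pmf (real n * \<alpha>)) a * (pmf (poisson_pmf (real n * \<beta>)) b *
        (fact a * fact b * good_coeff G n a b / real n ^ (a + b))) =
      exp (- (real n * \<alpha>)) * exp (- (real n * \<beta>)) * (\<alpha> ^ a * \<beta> ^ b * good_coeff G n a b)"
      using np n by (simp add: power_mult_distrib power_add)
    then have "pmf (poisson_pmf (real n * \<alpha>)) a * (pmf (poisson_pmf (real n * \<beta>)) b *
        (fact a * fact b * good_coeff G n a b / real n ^ (a + b))) =
      ?c ^ n * (\<alpha> ^ a * \<beta> ^ b * good_coeff G n a b)" unfolding e .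
    moreover have "0 \<le> fact a * fact b * good_coeff G n a b / real n ^ (a + b)"
      by (simp add: good_coeff_nonneg)
    moreover have "0 \<le> \<alpha> ^ a * \<beta> ^ b * good_coeff G n a b"
      using pos by (simp add: good_coeff_nonneg)
    ultimately show "ennreal (pmf (poisson_pmf (real n * \<alpha>)) a) * (ennreal (pmf (poisson_pmf (real n * \<beta>)) b) *
       ennreal (fact a * fact b * good_coeff G n a b / real n ^ (a + b))) =
       ennreal (?c ^ n) * ennreal (\<alpha> ^ a * \<beta> ^ b * good_coeff G n a b)"
      by (simp only: pmf_nonneg mult_nonneg_nonneg zero_le_power exp_ge_zero flip: ennreal_mult)
  qed
  also have "\<dots> = ennreal (?c ^ n) * (\<Sum>a. \<Sum>b. ennreal (\<alpha> ^ a * \<beta> ^ b * good_coeff G n a b))"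
    by (simp only: ennreal_suminf_cmult)
  also have "\<dots> = ennreal (?c ^ n) * (\<Sum>a. \<Sum>b. if G a b then ennreal (\<alpha> ^ a / fact a * (\<beta> ^ b / fact b)) else 0) ^ n"
    using good_coeff_generating_function[of \<alpha> \<beta> G n] pos by (simp only: less_imp_le)
  also have "\<dots> = (ennreal ?c * (\<Sum>a. \<Sum>b. if G a b then ennreal (\<alpha> ^ a / fact a * (\<beta> ^ b / fact b)) else 0)) ^ n"
    by (simp only: power_mult_distrib ennreal_power exp_ge_zero mult_nonneg_nonneg)
  also have "\<dots> = ennreal (measure_pmf.prob (pair_pmf (poisson_pmf \<alpha>) (poisson_pmf \<beta>)) {(a, b). G a b} ^ n)"
    unfolding good_pair_generating_function[OF pos] measure_pmf.emeasure_eq_measure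
    by (simp only: ennreal_power measure_nonneg)
  finally show ?thesis .
qed

section \<open>Poisson tails and monotone functions of Poisson variables\<close>

text \<open>
  The variance is summed directly, by writing \<open>(k - \<mu>)\<^sup>2\<close> in terms of the falling factorials
  \<open>k (k - 1)\<close>, \<open>k\<close> and \<open>1\<close>, each of which only shifts the exponential series.
\<close>

lemma poisson_Chebyshev:
  assumes "\<mu> > 0" "d > 0"
  shows "measure_pmf.prob (poisson_pmf \<mu>) {k. d \<le> \<bar>real k - \<mu>\<bar>} \<le> \<mu> / d\<^sup>2"
proof -
  let ?t = "\<lambda>k. \<mu> ^ k / fact k :: real"
  have s0: "?t sums exp \<mu>" using exp_converges[of \<mu>] by (simp add: divide_inverse_commute)
  have shift: "real (Suc k) * ?t (Suc k) = \<mu> * ?t k" for k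
    by (simp add: field_simps del: of_nat_Suc)
  have s1: "(\<lambda>k. real k * ?t k) sums (\<mu> * exp \<mu>)"
  proof -
    have "(\<lambda>k. real (Suc k) * ?t (Suc k)) = (\<lambda>k. \<mu> * ?t k)"
      using shift by blast
    then show ?thesis using sums_mult[OF s0, of \<mu>] sums_Suc_iff[of "\<lambda>k. real k * ?t k" "\<mu> * exp \<mu>"] by simp
  qed
  have s2: "(\<lambda>k. real k * (real k - 1) * ?t k) sums (\<mu>\<^sup>2 * exp \<mu>)"
  proof -
    have "(\<lambda>k. real (Suc k) * (real (Suc k) - 1) * ?t (Suc k)) = (\<lambda>k. \<mu> * (real k * ?t k))"
    proof
      fix k
      have "real (Suc k) * (real (Suc k) - 1) * ?t (Suc k) = real k * (real (Suc k) * ?t (Suc k))"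
        by simp
      then show "real (Suc k) * (real (Suc k) - 1) * ?t (Suc k) = \<mu> * (real k * ?t k)"
        unfolding shift by simp
    qed
    then show ?thesis using sums_mult[OF s1, of \<mu>]
        sums_Suc_iff[of "\<lambda>k. real k * (real k - 1) * ?t k" "\<mu>\<^sup>2 * exp \<mu>"]
      by (simp add: power2_eq_square mult.assoc)
  qed
  have var: "(\<lambda>k. pmf (poisson_pmf \<mu>) k * (real k - \<mu>)\<^sup>2) sums \<mu>"
  proof -
    have "(\<lambda>k. exp (-\<mu>) * ((real k * (real k - 1) * ?t k) + (1 - 2 * \<mu>) * (real k * ?t k) + \<mu>\<^sup>2 * ?t k))
        sums (exp (-\<mu>) * (\<mu>\<^sup>2 * exp \<mu> + (1 - 2 * \<mu>) * (\<mu> * exp \<mu>) + \<mu>\<^sup>2 * exp \<mu>))"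
      by (intro sums_mult sums_add s0 s1 s2)
    moreover have "exp (-\<mu>) * (\<mu>\<^sup>2 * exp \<mu> + (1 - 2 * \<mu>) * (\<mu> * exp \<mu>) + \<mu>\<^sup>2 * exp \<mu>) = \<mu>"
      by (simp add: exp_minus field_simps power2_eq_square)
    moreover have "exp (-\<mu>) * ((real k * (real k - 1) * ?t k) + (1 - 2 * \<mu>) * (real k * ?t k) + \<mu>\<^sup>2 * ?t k) =
       pmf (poisson_pmf \<mu>) k * (real k - \<mu>)\<^sup>2" for k
      using assms by (simp add: field_simps power2_eq_square)
    ultimately show ?thesis by simp
  qed
  have "(\<integral>\<^sup>+k. ennreal ((real k - \<mu>)\<^sup>2) \<partial>poisson_pmf \<mu>) = ennreal \<mu>"
  proof -
    have "(\<Sum>k. ennreal (pmf (poisson_pmf \<mu>) k) * ennreal ((real k - \<mu>)\<^sup>2)) =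
        (\<Sum>k. ennreal (pmf (poisson_pmf \<mu>) k * (real k - \<mu>)\<^sup>2))"
      by (intro suminf_cong) (simp only: ennreal_mult pmf_nonneg zero_le_power2)
    also have "\<dots> = ennreal \<mu>"
      by (rule suminf_ennreal_eq[OF _ var]) (simp only: pmf_nonneg zero_le_power2 mult_nonneg_nonneg)
    finally show ?thesis unfolding nn_integral_pmf_nat .
  qed
  note second_moment = this
  have "emeasure (poisson_pmf \<mu>) {k. d \<le> \<bar>real k - \<mu>\<bar>} \<le>
     (\<integral>\<^sup>+k. ennreal (1 / d\<^sup>2) * ennreal ((real k - \<mu>)\<^sup>2) \<partial>poisson_pmf \<mu>)"
  proof -
    have "indicator {k. d \<le> \<bar>real k - \<mu>\<bar>} k \<le> ennreal (1 / d\<^sup>2) * ennreal ((real k - \<mu>)\<^sup>2)" for k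
    proof (cases "d \<le> \<bar>real k - \<mu>\<bar>")
      case True
      then have "d\<^sup>2 \<le> (real k - \<mu>)\<^sup>2" using assms
        by (metis abs_of_pos abs_le_square_iff)
      then show ?thesis using assms True
        by (simp add: field_simps flip: ennreal_mult ennreal_1)
    qed simp
    then have "(\<integral>\<^sup>+k. indicator {k. d \<le> \<bar>real k - \<mu>\<bar>} k \<partial>poisson_pmf \<mu>) \<le>
       (\<integral>\<^sup>+k. ennreal (1 / d\<^sup>2) * ennreal ((real k - \<mu>)\<^sup>2) \<partial>poisson_pmf \<mu>)"
      by (intro nn_integral_mono) auto
    then show ?thesis by simp
  qed
  also have "\<dots> = ennreal (1 / d\<^sup>2) * (\<integral>\<^sup>+k. ennreal ((real k - \<mu>)\<^sup>2) \<partial>poisson_pmf \<mu>)"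
    by (rule nn_integral_cmult) simp
  also have "\<dots> = ennreal (\<mu> / d\<^sup>2)"
    unfolding second_moment using assms by (simp flip: ennreal_mult)
  finally show ?thesis
    using assms by (simp add: measure_pmf.emeasure_eq_measure)
qed

lemma poisson_lower_tail:
  assumes "\<mu> > 0" "d > 0" "real s \<le> \<mu> - d"
  shows "measure_pmf.prob (poisson_pmf \<mu>) {..<s} \<le> \<mu> / d\<^sup>2"
proof -
  have "measure_pmf.prob (poisson_pmf \<mu>) {..<s} \<le> measure_pmf.prob (poisson_pmf \<mu>) {k. d \<le> \<bar>real k - \<mu>\<bar>}"
    using assms by (intro measure_pmf.finite_measure_mono) auto
  then show ?thesis using poisson_Chebyshev[OF assms(1,2)] by linarith
qed

lemma poisson_upper_tail:
  assumes "\<mu> > 0" "d > 0" "\<mu> + d \<le> real s + 1"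
  shows "measure_pmf.prob (poisson_pmf \<mu>) {s<..} \<le> \<mu> / d\<^sup>2"
proof -
  have "{s<..} \<subseteq> {k. d \<le> \<bar>real k - \<mu>\<bar>}"
  proof
    fix k assume "k \<in> {s<..}"
    then have "real s + 1 \<le> real k" by auto
    then show "k \<in> {k. d \<le> \<bar>real k - \<mu>\<bar>}" using assms by auto
  qed
  then have "measure_pmf.prob (poisson_pmf \<mu>) {s<..} \<le> measure_pmf.prob (poisson_pmf \<mu>) {k. d \<le> \<bar>real k - \<mu>\<bar>}"
    by (intro measure_pmf.finite_measure_mono) auto
  then show ?thesis using poisson_Chebyshev[OF assms(1,2)] by linarith
qed

text \<open>
  Off the two tail events the monotone function is at most its value at \<open>(s, u)\<close>, and on them it is
  at most \<open>1\<close>.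
\<close>

lemma mono_expectation_le:
  fixes q :: "nat \<Rightarrow> nat \<Rightarrow> real"
  assumes q: "\<And>a b. 0 \<le> q a b" "\<And>a b. q a b \<le> 1"
    and mono: "\<And>a a' b b'. a \<le> a' \<Longrightarrow> b \<le> b' \<Longrightarrow> q a b \<le> q a' b'"
    and P: "(\<integral>\<^sup>+a. \<integral>\<^sup>+b. ennreal (q a b) \<partial>measure_pmf p\<^sub>2 \<partial>measure_pmf p\<^sub>1) = ennreal P" "P \<ge> 0"
  shows "P \<le> q s u + measure_pmf.prob p\<^sub>1 {s<..} + measure_pmf.prob p\<^sub>2 {u<..}"
proof -
  have "ennreal (q a b) \<le> ennreal (q s u) + indicator {s<..} a + indicator {u<..} b" for a b
  proof (cases "a > s \<or> b > u")
    case True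
    have "ennreal (q a b) \<le> 1" using q(2) by simp
    also have "\<dots> \<le> ennreal (q s u) + indicator {s<..} a + indicator {u<..} b"
      using True by (auto simp: indicator_def add_increasing add_increasing2)
    finally show ?thesis .
  next
    case False
    then have "ennreal (q a b) \<le> ennreal (q s u)" by (intro ennreal_leI mono) auto
    then show ?thesis by (simp add: add_increasing2)
  qed
  then have "(\<integral>\<^sup>+a. \<integral>\<^sup>+b. ennreal (q a b) \<partial>measure_pmf p\<^sub>2 \<partial>measure_pmf p\<^sub>1) \<le>
    (\<integral>\<^sup>+a. \<integral>\<^sup>+b. ennreal (q s u) + indicator {s<..} a + indicator {u<..} b \<partial>measure_pmf p\<^sub>2 \<partial>measure_pmf p\<^sub>1)"
    by (intro nn_integral_mono)
  also have "\<dots> = ennreal (q s u) + emeasure p\<^sub>1 {s<..} + emeasure p\<^sub>2 {u<..}"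
    by (simp add: nn_integral_add)
  also have "\<dots> = ennreal (q s u + measure p\<^sub>1 {s<..} + measure p\<^sub>2 {u<..})"
    by (simp add: measure_pmf.emeasure_eq_measure q)
  finally have "ennreal P \<le> ennreal (q s u + measure p\<^sub>1 {s<..} + measure p\<^sub>2 {u<..})"
    by (simp add: P)
  then show ?thesis using q(1) by (subst (asm) ennreal_le_iff) simp_all
qed

text \<open>
  The converse comparison: the function is at least \<open>q s u\<close> off the two lower tails, and
  \<open>q s u \<le> 1\<close> on them.
\<close>

lemma mono_expectation_ge:
  fixes q :: "nat \<Rightarrow> nat \<Rightarrow> real"
  assumes q: "\<And>a b. 0 \<le> q a b" "\<And>a b. q a b \<le> 1"
    and mono: "\<And>a a' b b'. a \<le> a' \<Longrightarrow> b \<le> b' \<Longrightarrow> q a b \<le> q a' b'"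
    and P: "(\<integral>\<^sup>+a. \<integral>\<^sup>+b. ennreal (q a b) \<partial>measure_pmf p\<^sub>2 \<partial>measure_pmf p\<^sub>1) = ennreal P" "P \<ge> 0"
  shows "q s u \<le> P + measure_pmf.prob p\<^sub>1 {..<s} + measure_pmf.prob p\<^sub>2 {..<u}"
proof -
  have "ennreal (q s u) \<le> ennreal (q a b) + indicator {..<s} a + indicator {..<u} b" for a b
  proof (cases "a < s \<or> b < u")
    case True
    have "ennreal (q s u) \<le> 1" using q(2) by simp
    also have "\<dots> \<le> ennreal (q a b) + indicator {..<s} a + indicator {..<u} b"
      using True by (auto simp: indicator_def add_increasing add_increasing2)
    finally show ?thesis .
  next
    case False
    then have "ennreal (q s u) \<le> ennreal (q a b)" by (intro ennreal_leI mono) auto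
    then show ?thesis by (simp add: add_increasing2)
  qed
  then have "(\<integral>\<^sup>+a. \<integral>\<^sup>+b. ennreal (q s u) \<partial>measure_pmf p\<^sub>2 \<partial>measure_pmf p\<^sub>1) \<le>
    (\<integral>\<^sup>+a. \<integral>\<^sup>+b. ennreal (q a b) + indicator {..<s} a + indicator {..<u} b \<partial>measure_pmf p\<^sub>2 \<partial>measure_pmf p\<^sub>1)"
    by (intro nn_integral_mono)
  also have "\<dots> = ennreal P + emeasure p\<^sub>1 {..<s} + emeasure p\<^sub>2 {..<u}"
    by (simp add: nn_integral_add P)
  also have "\<dots> = ennreal (P + measure p\<^sub>1 {..<s} + measure p\<^sub>2 {..<u})"
    by (simp add: measure_pmf.emeasure_eq_measure P)
  finally have "ennreal (q s u) \<le> ennreal (P + measure p\<^sub>1 {..<s} + measure p\<^sub>2 {..<u})"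
    by simp
  then show ?thesis using P(2) by (subst (asm) ennreal_le_iff) simp_all
qed

section \<open>The failure probability of a single type\<close>

definition poisson_cdf :: "nat \<Rightarrow> real \<Rightarrow> real" where
  "poisson_cdf r \<alpha> = (\<Sum>k\<le>r. \<alpha> ^ k / fact k * exp (- \<alpha>))"

lemma prob_poisson_le:
  assumes "\<alpha> > 0"
  shows "measure_pmf.prob (poisson_pmf \<alpha>) {..r} = poisson_cdf r \<alpha>"
  using assms by (simp add: measure_measure_pmf_finite poisson_cdf_def)

text \<open>
  The sum of independent Poisson variables is Poisson, by the binomial theorem.
\<close>

lemma prob_poisson_pair_sum_le:
  assumes "\<alpha> > 0" "\<beta> > 0"
  shows "measure_pmf.prob (pair_pmf (poisson_pmf \<alpha>) (poisson_pmf \<beta>)) {(a, b). a + b \<le> r} = poisson_cdf r (\<alpha> + \<beta>)"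
proof -
  have eq: "{(a, b). a + b \<le> r} = (\<lambda>(k, a). (a, k - a)) ` (SIGMA k:{..r}. {..k})"
    by (force simp: image_iff)
  have inj: "inj_on (\<lambda>(k, a). (a, k - a)) (SIGMA k:{..r}. {..k})"
    by (auto simp: inj_on_def)
  have "measure_pmf.prob (pair_pmf (poisson_pmf \<alpha>) (poisson_pmf \<beta>)) {(a, b). a + b \<le> r} =
     (\<Sum>(k, a)\<in>(SIGMA k:{..r}. {..k}). pmf (poisson_pmf \<alpha>) a * pmf (poisson_pmf \<beta>) (k - a))"
  proof -
    have "finite {(a, b). a + b \<le> r}" unfolding eq by simp
    then have "measure_pmf.prob (pair_pmf (poisson_pmf \<alpha>) (poisson_pmf \<beta>)) {(a, b). a + b \<le> r} =
      (\<Sum>p\<in>(\<lambda>(k, a). (a, k - a)) ` (SIGMA k:{..r}. {..k}). pmf (pair_pmf (poisson_pmf \<alpha>) (poisson_pmf \<beta>)) p)"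
      by (subst measure_measure_pmf_finite) (simp_all only: eq)
    also have "\<dots> = (\<Sum>(k, a)\<in>(SIGMA k:{..r}. {..k}). pmf (poisson_pmf \<alpha>) a * pmf (poisson_pmf \<beta>) (k - a))"
      by (subst sum.reindex[OF inj]) (intro sum.cong refl, simp add: pmf_pair case_prod_beta)
    finally show ?thesis .
  qed
  also have "\<dots> = (\<Sum>k\<le>r. \<Sum>a\<le>k. pmf (poisson_pmf \<alpha>) a * pmf (poisson_pmf \<beta>) (k - a))"
    by (simp add: sum.Sigma)
  also have "\<dots> = poisson_cdf r (\<alpha> + \<beta>)"
    unfolding poisson_cdf_def
  proof (rule sum.cong[OF refl])
    fix k
    show "(\<Sum>a\<le>k. pmf (poisson_pmf \<alpha>) a * pmf (poisson_pmf \<beta>) (k - a)) = (\<alpha> + \<beta>) ^ k / fact k * exp (- (\<alpha> + \<beta>))"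
      unfolding binomial_ring sum_divide_distrib sum_distrib_right
      using assms by (intro sum.cong refl) (simp add: binomial_fact exp_add exp_diff exp_minus field_simps)
  qed
  finally show ?thesis .
qed

definition counts_ok :: "nat \<Rightarrow> nat \<Rightarrow> nat \<Rightarrow> nat \<Rightarrow> bool" where
  "counts_ok r\<^sub>1 r\<^sub>2 a b \<longleftrightarrow> r\<^sub>1 < a \<and> r\<^sub>2 < a + b"

text \<open>
  Inclusion and exclusion for the two ways to fail. Failing both ways forces the second count alone
  to be at most \<open>r\<^sub>2\<close>, and this event is independent of the first count. That product is what makes
  the two completion times asymptotically independent.
\<close>

lemma prob_counts_not_ok:
  fixes r\<^sub>1 r\<^sub>2
  assumes "\<alpha> > 0" "\<beta> > 0"
  defines "q \<equiv> measure_pmf.prob (pair_pmf (poisson_pmf \<alpha>) (poisson_pmf \<beta>)) {(a, b). \<not> counts_ok r\<^sub>1 r\<^sub>2 a b}"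
  shows "q \<le> poisson_cdf r\<^sub>1 \<alpha> + poisson_cdf r\<^sub>2 (\<alpha> + \<beta>)"
    and "q \<ge> poisson_cdf r\<^sub>1 \<alpha> + poisson_cdf r\<^sub>2 (\<alpha> + \<beta>) - poisson_cdf r\<^sub>1 \<alpha> * poisson_cdf r\<^sub>2 \<beta>"
proof -
  let ?M = "pair_pmf (poisson_pmf \<alpha>) (poisson_pmf \<beta>)"
  let ?A = "{..r\<^sub>1} \<times> (UNIV :: nat set)" and ?B = "{(a, b). a + b \<le> r\<^sub>2}"
  have u: "{(a, b). \<not> counts_ok r\<^sub>1 r\<^sub>2 a b} = ?A \<union> ?B" by (auto simp: counts_ok_def)
  have A: "measure_pmf.prob ?M ?A = poisson_cdf r\<^sub>1 \<alpha>"
    by (subst measure_pmf_prob_product) (auto simp: prob_poisson_le assms)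
  have B: "measure_pmf.prob ?M ?B = poisson_cdf r\<^sub>2 (\<alpha> + \<beta>)"
    by (rule prob_poisson_pair_sum_le[OF assms(1,2)])
  have "measure_pmf.prob ?M (?A \<inter> ?B) \<le> measure_pmf.prob ?M ({..r\<^sub>1} \<times> {..r\<^sub>2})"
    by (intro measure_pmf.finite_measure_mono) auto
  also have "\<dots> = poisson_cdf r\<^sub>1 \<alpha> * poisson_cdf r\<^sub>2 \<beta>"
    by (subst measure_pmf_prob_product) (auto simp: prob_poisson_le assms)
  finally have AB: "measure_pmf.prob ?M (?A \<inter> ?B) \<le> poisson_cdf r\<^sub>1 \<alpha> * poisson_cdf r\<^sub>2 \<beta>" .
  have "q = measure_pmf.prob ?M ?A + measure_pmf.prob ?M ?B - measure_pmf.prob ?M (?A \<inter> ?B)"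
    unfolding q_def u by (rule measure_Un3) (auto simp: fmeasurable_def measure_pmf.emeasure_eq_measure)
  with A B AB show "q \<le> poisson_cdf r\<^sub>1 \<alpha> + poisson_cdf r\<^sub>2 (\<alpha> + \<beta>)"
    "q \<ge> poisson_cdf r\<^sub>1 \<alpha> + poisson_cdf r\<^sub>2 (\<alpha> + \<beta>) - poisson_cdf r\<^sub>1 \<alpha> * poisson_cdf r\<^sub>2 \<beta>"
    by (auto simp: measure_nonneg)
qed

lemma poisson_cdf_tendsto_0:
  assumes "filterlim \<beta> at_top F"
  shows "((\<lambda>n. poisson_cdf r (\<beta> n)) \<longlongrightarrow> 0) F"
proof -
  have "((\<lambda>x. x ^ k / fact k * exp (- x :: real)) \<longlongrightarrow> 0) at_top" for k
    using tendsto_mult_right_zero[OF tendsto_power_div_exp_0[of k], of "1 / fact k"]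
    by (simp add: exp_minus field_simps)
  then have "(poisson_cdf r \<longlongrightarrow> (\<Sum>k\<le>r. 0)) at_top"
    unfolding poisson_cdf_def by (intro tendsto_sum)
  then show ?thesis using filterlim_compose[OF _ assms, of "poisson_cdf r"] by simp
qed

text \<open>
  At \<open>\<alpha> = ln n + r ln ln n + x\<close> one has \<open>n exp (- \<alpha>) = exp (- x) / (ln n)\<^sup>r\<close>, while
  \<open>\<alpha>\<^sup>k\<close> is asymptotic to \<open>(ln n)\<^sup>k\<close>; therefore only the term \<open>k = r\<close> of the distribution
  function survives.
\<close>

lemma poisson_cdf_Gumbel_scaling:
  "(\<lambda>n. real n * poisson_cdf r (ln (real n) + real r * ln (ln (real n)) + x)) \<longlonglongrightarrow> exp (- x) / fact r"
proof -
  let ?a = "\<lambda>n. ln (real n) + real r * ln (ln (real n)) + x"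
  have l1: "(\<lambda>n. ?a n / ln (real n)) \<longlonglongrightarrow> 1" by real_asymp
  have l2: "(\<lambda>n. 1 / ln (real n)) \<longlonglongrightarrow> 0" by real_asymp
  \<comment> \<open>\<open>\<alpha>\<^sup>k / (ln n)\<^sup>r\<close> is split as \<open>(\<alpha> / ln n)\<^sup>k (1 / ln n)\<^bsup>r-k\<^esup>\<close>; the last factor tends to \<open>0\<close> unless \<open>k = r\<close>.\<close>
  have "(\<lambda>n. \<Sum>k\<le>r. exp (- x) / fact k * ((?a n / ln (real n)) ^ k * (1 / ln (real n)) ^ (r - k)))
     \<longlonglongrightarrow> (\<Sum>k\<le>r. exp (- x) / fact k * (1 ^ k * 0 ^ (r - k)))"
    by (intro tendsto_intros l1 l2)
  also have "(\<Sum>k\<le>r. exp (- x) / fact k * (1 ^ k * 0 ^ (r - k))) = (\<Sum>k\<in>{r}. exp (- x) / fact k)"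
    by (intro sum.mono_neutral_cong_right) auto
  finally have lim: "(\<lambda>n. \<Sum>k\<le>r. exp (- x) / fact k * ((?a n / ln (real n)) ^ k * (1 / ln (real n)) ^ (r - k)))
     \<longlonglongrightarrow> exp (- x) / fact r" by simp
  show ?thesis
  proof (rule Lim_transform_eventually[OF lim])
    show "\<forall>\<^sub>F n in sequentially. (\<Sum>k\<le>r. exp (- x) / fact k * ((?a n / ln (real n)) ^ k * (1 / ln (real n)) ^ (r - k)))
       = real n * poisson_cdf r (?a n)"
      using eventually_ge_at_top[of "2::nat"]
    proof eventually_elim
      fix n :: nat assume n: "2 \<le> n"
      define l where "l = ln (real n)"
      have l: "l > 0" using n by (simp add: l_def)
      have "exp (- ?a n) = exp (- ln (real n)) * exp (- (real r * ln l)) * exp (- x)"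
        by (simp add: l_def flip: exp_add)
      also have "\<dots> = 1 / real n * (1 / l ^ r) * exp (- x)"
        using n l by (simp add: exp_minus exp_of_nat_mult inverse_eq_divide)
      finally have e: "exp (- ?a n) = 1 / real n * (1 / l ^ r) * exp (- x)" .
      show "(\<Sum>k\<le>r. exp (- x) / fact k * ((?a n / ln (real n)) ^ k * (1 / ln (real n)) ^ (r - k)))
       = real n * poisson_cdf r (?a n)"
        unfolding poisson_cdf_def sum_distrib_left e unfolding l_def[symmetric]
      proof (rule sum.cong[OF refl])
        fix k assume "k \<in> {..r}"
        then have "l ^ r = l ^ k * l ^ (r - k)" by (simp flip: power_add)
        then show "exp (- x) / fact k * (((l + real r * ln l + x) / l) ^ k * (1 / l) ^ (r - k)) =
          real n * ((l + real r * ln l + x) ^ k / fact k * (1 / real n * (1 / l ^ r) * exp (- x)))"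
          using n l by (simp add: field_simps)
      qed
    qed
  qed
qed

lemma power_one_minus_tendsto_exp:
  assumes lim: "(\<lambda>n. real n * q n) \<longlonglongrightarrow> \<mu>" and q: "\<And>n. 0 \<le> q n"
  shows "(\<lambda>n. (1 - q n) ^ n) \<longlonglongrightarrow> exp (- \<mu>)"
proof -
  have q0: "q \<longlonglongrightarrow> 0"
  proof -
    have "(\<lambda>n. (real n * q n) * (1 / real n)) \<longlonglongrightarrow> \<mu> * 0"
      by (intro tendsto_mult lim) real_asymp
    moreover have "\<forall>\<^sub>F n in sequentially. (real n * q n) * (1 / real n) = q n"
      using eventually_gt_at_top[of "0::nat"] by eventually_elim simp
    ultimately show ?thesis using Lim_transform_eventually by fastforce
  qed
  have "\<forall>\<^sub>F n in sequentially. q n < 1 / 2" using q0 by (rule order_tendstoD) simp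
  then have bd: "\<forall>\<^sub>F n in sequentially. q n \<le> 1 / 2" by eventually_elim simp
  have "(\<lambda>n. real n * ln (1 - q n)) \<longlonglongrightarrow> - \<mu>"
  proof (rule tendsto_sandwich)
    show "(\<lambda>n. - (real n * q n) - 2 * (real n * q n) * q n) \<longlonglongrightarrow> - \<mu>"
      using tendsto_diff[OF tendsto_minus[OF lim] tendsto_mult[OF tendsto_mult[OF tendsto_const[of 2] lim] q0]]
      by simp
    show "(\<lambda>n. - (real n * q n)) \<longlonglongrightarrow> - \<mu>" by (intro tendsto_intros lim)
    show "\<forall>\<^sub>F n in sequentially. - (real n * q n) - 2 * (real n * q n) * q n \<le> real n * ln (1 - q n)"
      using bd
    proof eventually_elim
      case (elim n)
      have "real n * (- q n - 2 * (q n)\<^sup>2) \<le> real n * ln (1 - q n)"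
        using elim q by (intro mult_left_mono ln_one_minus_pos_lower_bound) auto
      then show ?case by (simp add: algebra_simps power2_eq_square)
    qed
    show "\<forall>\<^sub>F n in sequentially. real n * ln (1 - q n) \<le> - (real n * q n)"
      using bd
    proof eventually_elim
      case (elim n)
      have "real n * ln (1 - q n) \<le> real n * (- q n)"
        using elim q by (intro mult_left_mono ln_one_minus_pos_upper_bound) (auto intro: le_less_trans[OF elim])
      then show ?case by simp
    qed
  qed
  then have "(\<lambda>n. exp (real n * ln (1 - q n))) \<longlonglongrightarrow> exp (- \<mu>)" by (rule tendsto_exp)
  then show ?thesis
    by (rule Lim_transform_eventually)
      (use bd in eventually_elim, simp add: exp_of_nat_mult)
qed

text \<open>
  The centring at which collector \<open>r\<close> completes, in units of \<open>n\<close> draws and with offset \<open>x\<close>.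
\<close>

definition threshold :: "nat \<Rightarrow> real \<Rightarrow> nat \<Rightarrow> real" where
  "threshold r x n = ln (real n) + real r * ln (ln (real n)) + x"

lemma threshold_at_top: "filterlim (threshold r x) at_top sequentially"
  unfolding threshold_def by real_asymp

text \<open>
  The mean number of further coupons of a given type between the two thresholds. Because
  it diverges, a type that is late for the first collector is unlikely to be late for the second.
\<close>

lemma threshold_gap_at_top:
  assumes "r\<^sub>1 < r\<^sub>2"
  shows "filterlim (\<lambda>n. threshold r\<^sub>2 y n - threshold r\<^sub>1 x n) at_top sequentially"
proof -
  have pos: "real r\<^sub>2 - real r\<^sub>1 > 0" using assms by simp
  have "filterlim (\<lambda>n. ln (ln (real n))) at_top sequentially" by real_asymp
  then have "filterlim (\<lambda>n. (y - x) + (real r\<^sub>2 - real r\<^sub>1) * ln (ln (real n))) at_top sequentially"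
    using pos by (intro filterlim_tendsto_add_at_top[OF tendsto_const] filterlim_tendsto_pos_mult_at_top[OF tendsto_const])
  then show ?thesis by (simp add: threshold_def algebra_simps)
qed

lemma threshold_div_tendsto_0: "(\<lambda>n. threshold r x n / real n) \<longlonglongrightarrow> 0"
  unfolding threshold_def by real_asymp

text \<open>
  The failure probability \<open>q\<close> of a single type satisfies
  \<open>n q \<longlonglongrightarrow> exp (- x) / r\<^sub>1! + exp (- y) / r\<^sub>2!\<close>, since the probability of failing both
  ways is \<open>o(1 / n)\<close>.
\<close>

lemma poissonized_limit:
  fixes r\<^sub>1 r\<^sub>2 :: nat and x y :: real
  assumes "r\<^sub>1 < r\<^sub>2"
  defines "\<alpha> \<equiv> threshold r\<^sub>1 x" and "\<gamma> \<equiv> threshold r\<^sub>2 y"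
  shows "(\<lambda>n. measure_pmf.prob (pair_pmf (poisson_pmf (\<alpha> n)) (poisson_pmf (\<gamma> n - \<alpha> n))) {(a, b). counts_ok r\<^sub>1 r\<^sub>2 a b} ^ n)
    \<longlonglongrightarrow> exp (- (exp (- x) / fact r\<^sub>1 + exp (- y) / fact r\<^sub>2))"
proof -
  define p where "p n = pair_pmf (poisson_pmf (\<alpha> n)) (poisson_pmf (\<gamma> n - \<alpha> n))" for n
  define q where "q n = measure_pmf.prob (p n) {(a, b). \<not> counts_ok r\<^sub>1 r\<^sub>2 a b}" for n
  have l1: "(\<lambda>n. real n * poisson_cdf r\<^sub>1 (\<alpha> n)) \<longlonglongrightarrow> exp (- x) / fact r\<^sub>1"
    using poisson_cdf_Gumbel_scaling[of r\<^sub>1 x] by (simp add: \<alpha>_def threshold_def)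
  have l2: "(\<lambda>n. real n * poisson_cdf r\<^sub>2 (\<gamma> n)) \<longlonglongrightarrow> exp (- y) / fact r\<^sub>2"
    using poisson_cdf_Gumbel_scaling[of r\<^sub>2 y] by (simp add: \<gamma>_def threshold_def)
  have b: "filterlim (\<lambda>n. \<gamma> n - \<alpha> n) at_top sequentially"
    unfolding \<alpha>_def \<gamma>_def by (rule threshold_gap_at_top[OF assms(1)])
  have l3: "(\<lambda>n. poisson_cdf r\<^sub>2 (\<gamma> n - \<alpha> n)) \<longlonglongrightarrow> 0"
    by (rule poisson_cdf_tendsto_0[OF b])
  have ev: "\<forall>\<^sub>F n in sequentially. 0 < \<alpha> n \<and> 0 < \<gamma> n - \<alpha> n"
    using filterlim_at_top_dense[THEN iffD1, OF b, rule_format, of 0]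
      filterlim_at_top_dense[THEN iffD1, OF threshold_at_top[of r\<^sub>1 x], rule_format, of 0]
    unfolding \<alpha>_def[symmetric] by eventually_elim simp
  have "(\<lambda>n. real n * q n) \<longlonglongrightarrow> exp (- x) / fact r\<^sub>1 + exp (- y) / fact r\<^sub>2"
  proof (rule tendsto_sandwich)
    show "(\<lambda>n. real n * poisson_cdf r\<^sub>1 (\<alpha> n) + real n * poisson_cdf r\<^sub>2 (\<gamma> n) -
        real n * poisson_cdf r\<^sub>1 (\<alpha> n) * poisson_cdf r\<^sub>2 (\<gamma> n - \<alpha> n)) \<longlonglongrightarrow>
      exp (- x) / fact r\<^sub>1 + exp (- y) / fact r\<^sub>2"
      using tendsto_diff[OF tendsto_add[OF l1 l2] tendsto_mult[OF l1 l3]] by simp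
    show "(\<lambda>n. real n * poisson_cdf r\<^sub>1 (\<alpha> n) + real n * poisson_cdf r\<^sub>2 (\<gamma> n)) \<longlonglongrightarrow>
      exp (- x) / fact r\<^sub>1 + exp (- y) / fact r\<^sub>2"
      by (rule tendsto_add[OF l1 l2])
    show "\<forall>\<^sub>F n in sequentially. real n * poisson_cdf r\<^sub>1 (\<alpha> n) + real n * poisson_cdf r\<^sub>2 (\<gamma> n) -
        real n * poisson_cdf r\<^sub>1 (\<alpha> n) * poisson_cdf r\<^sub>2 (\<gamma> n - \<alpha> n) \<le> real n * q n"
      using ev
    proof eventually_elim
      case (elim n)
      then have "poisson_cdf r\<^sub>1 (\<alpha> n) + poisson_cdf r\<^sub>2 (\<gamma> n) - poisson_cdf r\<^sub>1 (\<alpha> n) * poisson_cdf r\<^sub>2 (\<gamma> n - \<alpha> n) \<le> q n"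
        using prob_counts_not_ok(2)[of "\<alpha> n" "\<gamma> n - \<alpha> n" r\<^sub>1 r\<^sub>2] by (simp add: q_def p_def)
      from mult_left_mono[OF this, of "real n"] show ?case by (simp add: algebra_simps)
    qed
    show "\<forall>\<^sub>F n in sequentially. real n * q n \<le> real n * poisson_cdf r\<^sub>1 (\<alpha> n) + real n * poisson_cdf r\<^sub>2 (\<gamma> n)"
      using ev
    proof eventually_elim
      case (elim n)
      then have "q n \<le> poisson_cdf r\<^sub>1 (\<alpha> n) + poisson_cdf r\<^sub>2 (\<gamma> n)"
        using prob_counts_not_ok(1)[of "\<alpha> n" "\<gamma> n - \<alpha> n" r\<^sub>1 r\<^sub>2] by (simp add: q_def p_def)
      from mult_left_mono[OF this, of "real n"] show ?case by (simp add: algebra_simps)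
    qed
  qed
  then have "(\<lambda>n. (1 - q n) ^ n) \<longlonglongrightarrow> exp (- (exp (- x) / fact r\<^sub>1 + exp (- y) / fact r\<^sub>2))"
    by (rule power_one_minus_tendsto_exp) (simp add: q_def)
  moreover have "1 - q n = measure_pmf.prob (p n) {(a, b). counts_ok r\<^sub>1 r\<^sub>2 a b}" for n
  proof -
    have "{(a, b). counts_ok r\<^sub>1 r\<^sub>2 a b} = UNIV - {(a, b). \<not> counts_ok r\<^sub>1 r\<^sub>2 a b}" by auto
    then show ?thesis
      using measure_pmf.prob_compl[of "{(a, b). \<not> counts_ok r\<^sub>1 r\<^sub>2 a b}" "p n"] by (simp add: q_def)
  qed
  ultimately show ?thesis by (simp add: p_def)
qed

section \<open>Removing the randomness of the block lengths\<close>

text \<open>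
  Shifting the offsets by \<open>\<delta>\<close> and \<open>2 \<delta>\<close> lengthens (\<open>\<delta> > 0\<close>) or shortens (\<open>\<delta> < 0\<close>) both
  blocks on average by \<open>\<bar>\<delta>\<bar> n\<close>, which exceeds the fluctuations of their Poisson lengths. By
  monotonicity the sequence is squeezed between Poissonized sequences, whose limits depend
  continuously on \<open>\<delta>\<close>. The hypotheses on \<open>a\<close> and \<open>b\<close> say that \<open>a n\<close> and \<open>a n + b n\<close> are the
  integer parts of the two thresholds.
\<close>

lemma depoissonization:
  fixes q :: "nat \<Rightarrow> nat \<Rightarrow> nat \<Rightarrow> real"
  assumes r: "r\<^sub>1 < r\<^sub>2"
    and q: "\<And>n a b. 1 \<le> n \<Longrightarrow> 0 \<le> q n a b" "\<And>n a b. 1 \<le> n \<Longrightarrow> q n a b \<le> 1"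
    and mono: "\<And>n a a' b b'. 1 \<le> n \<Longrightarrow> a \<le> a' \<Longrightarrow> b \<le> b' \<Longrightarrow> q n a b \<le> q n a' b'"
    and poisson: "\<And>n \<alpha> \<beta>. 1 \<le> n \<Longrightarrow> 0 < \<alpha> \<Longrightarrow> 0 < \<beta> \<Longrightarrow>
      (\<integral>\<^sup>+a. \<integral>\<^sup>+b. ennreal (q n a b) \<partial>poisson_pmf (real n * \<beta>) \<partial>poisson_pmf (real n * \<alpha>)) =
      ennreal (measure_pmf.prob (pair_pmf (poisson_pmf \<alpha>) (poisson_pmf \<beta>)) {(a, b). counts_ok r\<^sub>1 r\<^sub>2 a b} ^ n)"
    and a: "\<forall>\<^sub>F n in sequentially. real (a n) \<le> real n * threshold r\<^sub>1 x n \<and> real n * threshold r\<^sub>1 x n < real (a n) + 1"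
    and b: "\<forall>\<^sub>F n in sequentially. real (a n) + real (b n) \<le> real n * threshold r\<^sub>2 y n \<and>
      real n * threshold r\<^sub>2 y n < real (a n) + real (b n) + 1"
  shows "(\<lambda>n. q n (a n) (b n)) \<longlonglongrightarrow> exp (- (exp (- x) / fact r\<^sub>1 + exp (- y) / fact r\<^sub>2))"
proof -
  define \<alpha> where "\<alpha> \<delta> = threshold r\<^sub>1 (x + \<delta>)" for \<delta>
  define \<beta> where "\<beta> \<delta> n = threshold r\<^sub>2 (y + 2 * \<delta>) n - \<alpha> \<delta> n" for \<delta> n
  define P where "P \<delta> n = measure_pmf.prob (pair_pmf (poisson_pmf (\<alpha> \<delta> n)) (poisson_pmf (\<beta> \<delta> n))) {(a, b). counts_ok r\<^sub>1 r\<^sub>2 a b} ^ n" for \<delta> n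
  \<comment> \<open>Chebyshev bounds for deviations by \<open>n \<bar>\<delta>\<bar> / 2\<close>; the other half of the shift absorbs the rounding of the block lengths.\<close>
  define err where "err \<delta> n = 4 / \<delta>\<^sup>2 * (\<alpha> \<delta> n / real n) + 4 / \<delta>\<^sup>2 * (\<beta> \<delta> n / real n)" for \<delta> n
  define L where "L \<delta> = exp (- (exp (- (x + \<delta>)) / fact r\<^sub>1 + exp (- (y + 2 * \<delta>)) / fact r\<^sub>2))" for \<delta>
  have P: "P \<delta> \<longlonglongrightarrow> L \<delta>" for \<delta>
    unfolding P_def L_def \<alpha>_def \<beta>_def by (rule poissonized_limit[OF r])
  have err: "err \<delta> \<longlonglongrightarrow> 0" for \<delta>
  proof -
    have "(\<lambda>n. \<alpha> \<delta> n / real n) \<longlonglongrightarrow> 0"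
      unfolding \<alpha>_def by (rule threshold_div_tendsto_0)
    moreover have "(\<lambda>n. \<beta> \<delta> n / real n) \<longlonglongrightarrow> 0 - 0"
      unfolding \<beta>_def \<alpha>_def diff_divide_distrib by (intro tendsto_diff threshold_div_tendsto_0)
    ultimately have "err \<delta> \<longlonglongrightarrow> 4 / \<delta>\<^sup>2 * 0 + 4 / \<delta>\<^sup>2 * (0 - 0)"
      unfolding err_def by (intro tendsto_add tendsto_mult tendsto_const)
    then show ?thesis by simp
  qed
  have ev: "\<forall>\<^sub>F n in sequentially. 1 \<le> n \<and> 0 < \<alpha> \<delta> n \<and> 0 < \<beta> \<delta> n \<and> 1 \<le> real n * (\<bar>\<delta>\<bar> / 2)" if "\<delta> \<noteq> 0" for \<delta>
  proof -
    have 1: "\<forall>\<^sub>F n in sequentially. 0 < \<alpha> \<delta> n"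
      using filterlim_at_top_dense[THEN iffD1, OF threshold_at_top, rule_format] unfolding \<alpha>_def .
    have 2: "\<forall>\<^sub>F n in sequentially. 0 < \<beta> \<delta> n"
      using filterlim_at_top_dense[THEN iffD1, OF threshold_gap_at_top[OF r], rule_format] unfolding \<alpha>_def \<beta>_def .
    have 3: "\<forall>\<^sub>F n in sequentially. 1 / (\<bar>\<delta>\<bar> / 2) \<le> real n"
      using filterlim_at_top[THEN iffD1, OF filterlim_real_sequentially] by blast
    show ?thesis using 1 2 3 eventually_ge_at_top[of "1::nat"]
      by eventually_elim (use that in \<open>simp add: field_simps\<close>)
  qed
  have split: "real n * \<alpha> \<delta> n = real n * threshold r\<^sub>1 x n + real n * \<delta>"
    "real n * \<beta> \<delta> n = real n * threshold r\<^sub>2 y n - real n * threshold r\<^sub>1 x n + real n * \<delta>" for \<delta> n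
    by (simp_all add: \<alpha>_def \<beta>_def threshold_def algebra_simps)
  have cheb: "real n * \<mu> / (real n * (\<bar>\<delta>\<bar> / 2))\<^sup>2 = 4 / \<delta>\<^sup>2 * (\<mu> / real n)" if "1 \<le> n" for n :: nat and \<mu> \<delta> :: real
  proof -
    have "(real n * (\<bar>\<delta>\<bar> / 2))\<^sup>2 = (real n)\<^sup>2 * \<delta>\<^sup>2 / 4"
      by (simp add: power_mult_distrib power_divide)
    then show ?thesis using that by (simp only:) (simp add: power2_eq_square ac_simps)
  qed
  have upper: "\<forall>\<^sub>F n in sequentially. q n (a n) (b n) \<le> P \<delta> n + err \<delta> n" if sign: "\<delta> > 0" and nz: "\<delta> \<noteq> 0" for \<delta>
    using ev[OF nz] a b
  proof eventually_elim
    case (elim n)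
    define d where "d = real n * (\<bar>\<delta>\<bar> / 2)"
    have n: "1 \<le> n" and ab: "0 < \<alpha> \<delta> n" "0 < \<beta> \<delta> n" and d1: "1 \<le> d"
      using elim(1) by (simp_all add: d_def)
    have d: "0 < d" "real n * \<delta> = d + d" using d1 sign by (simp_all add: d_def)
    have pos: "real n * \<alpha> \<delta> n > 0" "real n * \<beta> \<delta> n > 0" using n ab by simp_all
    have "q n (a n) (b n) \<le> P \<delta> n + measure_pmf.prob (poisson_pmf (real n * \<alpha> \<delta> n)) {..<a n} +
        measure_pmf.prob (poisson_pmf (real n * \<beta> \<delta> n)) {..<b n}"
    proof (rule mono_expectation_ge[where q = "q n"])
      show "(\<integral>\<^sup>+a. \<integral>\<^sup>+b. ennreal (q n a b) \<partial>poisson_pmf (real n * \<beta> \<delta> n) \<partial>poisson_pmf (real n * \<alpha> \<delta> n)) = ennreal (P \<delta> n)"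
        unfolding P_def by (rule poisson[OF n ab])
      show "0 \<le> P \<delta> n" by (simp add: P_def)
    qed (fact q(1)[OF n] q(2)[OF n] mono[OF n])+
    moreover have "measure_pmf.prob (poisson_pmf (real n * \<alpha> \<delta> n)) {..<a n} \<le> real n * \<alpha> \<delta> n / d\<^sup>2"
      by (rule poisson_lower_tail[OF pos(1) d(1)]) (use elim(2) d d1 split(1)[of n \<delta>] in linarith)
    moreover have "measure_pmf.prob (poisson_pmf (real n * \<beta> \<delta> n)) {..<b n} \<le> real n * \<beta> \<delta> n / d\<^sup>2"
      by (rule poisson_lower_tail[OF pos(2) d(1)]) (use elim(2,3) d d1 split(2)[of n \<delta>] in linarith)
    moreover have "err \<delta> n = real n * \<alpha> \<delta> n / d\<^sup>2 + real n * \<beta> \<delta> n / d\<^sup>2"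
      unfolding err_def d_def cheb[OF n] ..
    ultimately show ?case by linarith
  qed
  have lower: "\<forall>\<^sub>F n in sequentially. P \<delta> n - err \<delta> n \<le> q n (a n) (b n)" if sign: "\<delta> < 0" and nz: "\<delta> \<noteq> 0" for \<delta>
    using ev[OF nz] a b
  proof eventually_elim
    case (elim n)
    define d where "d = real n * (\<bar>\<delta>\<bar> / 2)"
    have n: "1 \<le> n" and ab: "0 < \<alpha> \<delta> n" "0 < \<beta> \<delta> n" and d1: "1 \<le> d"
      using elim(1) by (simp_all add: d_def)
    have d: "0 < d" "real n * \<delta> = - (d + d)" using d1 sign by (simp_all add: d_def)
    have pos: "real n * \<alpha> \<delta> n > 0" "real n * \<beta> \<delta> n > 0" using n ab by simp_all
    have "P \<delta> n \<le> q n (a n) (b n) + measure_pmf.prob (poisson_pmf (real n * \<alpha> \<delta> n)) {a n<..} +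
        measure_pmf.prob (poisson_pmf (real n * \<beta> \<delta> n)) {b n<..}"
    proof (rule mono_expectation_le[where q = "q n"])
      show "(\<integral>\<^sup>+a. \<integral>\<^sup>+b. ennreal (q n a b) \<partial>poisson_pmf (real n * \<beta> \<delta> n) \<partial>poisson_pmf (real n * \<alpha> \<delta> n)) = ennreal (P \<delta> n)"
        unfolding P_def by (rule poisson[OF n ab])
      show "0 \<le> P \<delta> n" by (simp add: P_def)
    qed (fact q(1)[OF n] q(2)[OF n] mono[OF n])+
    moreover have "measure_pmf.prob (poisson_pmf (real n * \<alpha> \<delta> n)) {a n<..} \<le> real n * \<alpha> \<delta> n / d\<^sup>2"
      by (rule poisson_upper_tail[OF pos(1) d(1)]) (use elim(2) d d1 split(1)[of n \<delta>] in linarith)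
    moreover have "measure_pmf.prob (poisson_pmf (real n * \<beta> \<delta> n)) {b n<..} \<le> real n * \<beta> \<delta> n / d\<^sup>2"
      by (rule poisson_upper_tail[OF pos(2) d(1)]) (use elim(2,3) d d1 split(2)[of n \<delta>] in linarith)
    moreover have "err \<delta> n = real n * \<alpha> \<delta> n / d\<^sup>2 + real n * \<beta> \<delta> n / d\<^sup>2"
      unfolding err_def d_def cheb[OF n] ..
    ultimately show ?case by linarith
  qed
  have contL: "(L \<longlongrightarrow> L 0) (at 0 within S)" for S
  proof -
    have "isCont L 0" unfolding L_def by (intro continuous_intros) auto
    then show ?thesis using continuous_at_imp_continuous_at_within continuous_within by blast
  qed
  have "(\<lambda>n. q n (a n) (b n)) \<longlonglongrightarrow> L 0"
  proof (rule order_tendstoI)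
    fix u assume "L 0 < u"
    then have "\<forall>\<^sub>F \<delta> in at_right 0. L \<delta> < u \<and> 0 < \<delta>"
      using order_tendstoD(2)[OF contL] eventually_at_right_less eventually_conj by blast
    then obtain \<delta> where \<delta>: "L \<delta> < u" "0 < \<delta>"
      using eventually_happens[of _ "at_right (0::real)"] by auto
    have "(\<lambda>n. P \<delta> n + err \<delta> n) \<longlonglongrightarrow> L \<delta> + 0" by (intro tendsto_add P err)
    then have "\<forall>\<^sub>F n in sequentially. P \<delta> n + err \<delta> n < u" using \<delta> by (intro order_tendstoD(2)) auto
    with upper[OF \<delta>(2) less_imp_neq[OF \<delta>(2), symmetric]] show "\<forall>\<^sub>F n in sequentially. q n (a n) (b n) < u"
      by eventually_elim simp
  next
    fix l assume "l < L 0"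
    moreover have "\<forall>\<^sub>F \<delta> in at_left 0. \<delta> < (0::real)" by (simp add: eventually_at_filter)
    ultimately have "\<forall>\<^sub>F \<delta> in at_left 0. l < L \<delta> \<and> \<delta> < 0"
      using order_tendstoD(1)[OF contL] eventually_conj by blast
    then obtain \<delta> where \<delta>: "l < L \<delta>" "\<delta> < 0"
      using eventually_happens[of _ "at_left (0::real)"] by auto
    have "(\<lambda>n. P \<delta> n - err \<delta> n) \<longlonglongrightarrow> L \<delta> - 0" by (intro tendsto_diff P err)
    then have "\<forall>\<^sub>F n in sequentially. l < P \<delta> n - err \<delta> n" using \<delta> by (intro order_tendstoD(1)) auto
    with lower[OF \<delta>(2) less_imp_neq[OF \<delta>(2)]] show "\<forall>\<^sub>F n in sequentially. l < q n (a n) (b n)"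
      by eventually_elim simp
  qed
  then show ?thesis by (simp add: L_def)
qed

section \<open>The coupon process\<close>

text \<open>
  The elements up to \<open>m\<close> of an infinite set are its first ones in the enumeration, so their
  number determines which indices have been reached.
\<close>

lemma enumerate_le_iff:
  fixes S :: "nat set"
  assumes "infinite S"
  shows "enumerate S r \<le> m \<longleftrightarrow> r < card (S \<inter> {..m})"
proof -
  let ?K = "{k. enumerate S k \<le> m}"
  have img: "S \<inter> {..m} = enumerate S ` ?K"
    using range_enumerate[OF assms] by auto
  have finK: "finite ?K"
    by (rule finite_subset[of _ "{..m}"]) (auto intro: order_trans[OF le_enumerate[OF assms]])
  have card: "card (S \<inter> {..m}) = card ?K"
    unfolding img by (intro card_image inj_on_subset[OF inj_enumerate[OF assms]]) simp
  show ?thesis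
  proof
    assume "enumerate S r \<le> m"
    then have "{..r} \<subseteq> ?K"
      using assms by (auto intro: order_trans[of _ "enumerate S r"])
    then have "card {..r} \<le> card ?K" by (rule card_mono[OF finK])
    then show "r < card (S \<inter> {..m})" by (simp add: card)
  next
    assume r: "r < card (S \<inter> {..m})"
    show "enumerate S r \<le> m"
    proof (rule ccontr)
      assume "\<not> enumerate S r \<le> m"
      then have lt: "enumerate S k < enumerate S r" if "k \<in> ?K" for k
        using that by simp
      have "?K \<subseteq> {..<r}"
        using lt enumerate_mono_iff[OF assms] by blast
      then have "card ?K \<le> card {..<r}" by (rule card_mono[rotated]) simp
      then show False using r card by simp
    qed
  qed
qed

text \<open>
  Generalising over the random set is essential, because \<^const>\<open>enumerate\<close> recurses on the set
  with its least element removed.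
\<close>

lemma measurable_enumerate:
  fixes S :: "'a \<Rightarrow> nat set"
  assumes "\<And>t. Measurable.pred M (\<lambda>\<omega>. t \<in> S \<omega>)"
  shows "(\<lambda>\<omega>. enumerate (S \<omega>) r) \<in> measurable M (count_space UNIV)"
  using assms
proof (induction r arbitrary: S)
  case 0
  show ?case unfolding enumerate_0 by (rule measurable_Least) (use 0 in simp)
next
  case (Suc r)
  have [measurable]: "(\<lambda>\<omega>. LEAST t. t \<in> S \<omega>) \<in> measurable M (count_space UNIV)"
    by (rule measurable_Least) (use Suc.prems in simp)
  note [measurable] = Suc.prems
  show ?case unfolding enumerate_Suc
  proof (rule Suc.IH)
    fix t
    have "Measurable.pred M (\<lambda>\<omega>. t \<in> S \<omega> \<and> t \<noteq> (LEAST t. t \<in> S \<omega>))" by measurable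
    then show "Measurable.pred M (\<lambda>\<omega>. t \<in> S \<omega> - {LEAST t. t \<in> S \<omega>})" by simp
  qed
qed

text \<open>
  Collector \<open>r\<close> has completed by time \<open>m\<close>. Unlike an inequality for \<^const>\<open>completion_time\<close>, this
  form depends on the first \<open>m\<close> draws only, so its probability is a finite counting problem.
\<close>

definition collected :: "nat \<Rightarrow> (nat \<Rightarrow> 'a \<Rightarrow> nat) \<Rightarrow> nat \<Rightarrow> nat \<Rightarrow> 'a \<Rightarrow> bool" where
  "collected n X r m \<omega> \<longleftrightarrow> (\<forall>i\<in>{1..n}. r < card {t\<in>{1..m}. X t \<omega> = i})"

lemma collected_mono: "collected n X r m \<omega> \<Longrightarrow> m \<le> m' \<Longrightarrow> collected n X r m' \<omega>"
  unfolding collected_def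
proof (intro ballI)
  fix i assume *: "\<forall>i\<in>{1..n}. r < card {t \<in> {1..m}. X t \<omega> = i}" "m \<le> m'" "i \<in> {1..n}"
  have "card {t \<in> {1..m}. X t \<omega> = i} \<le> card {t \<in> {1..m'}. X t \<omega> = i}"
    using * by (intro card_mono) auto
  with * show "r < card {t \<in> {1..m'}. X t \<omega> = i}" by force
qed

lemma collected_twice_iff_good_words:
  assumes disj: "A \<inter> B = {}" and AB: "A \<union> B = {1..a+b}" and A: "A = {1..a}"
    and range: "\<forall>t\<in>A \<union> B. X t \<omega> \<in> {1..n}"
  shows "collected n X r\<^sub>1 a \<omega> \<and> collected n X r\<^sub>2 (a + b) \<omega> \<longleftrightarrow>
    restrict (\<lambda>t. X t \<omega>) (A \<union> B) \<in> good_words (counts_ok r\<^sub>1 r\<^sub>2) n A B"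
proof -
  have fin: "finite A" "finite B" using AB by (metis finite_Un finite_atLeastAtMost)+
  have split: "card {t\<in>A \<union> B. X t \<omega> = i} = card {t\<in>A. X t \<omega> = i} + card {t\<in>B. X t \<omega> = i}" for i
  proof -
    have "{t\<in>A \<union> B. X t \<omega> = i} = {t\<in>A. X t \<omega> = i} \<union> {t\<in>B. X t \<omega> = i}" by blast
    moreover have "card ({t\<in>A. X t \<omega> = i} \<union> {t\<in>B. X t \<omega> = i}) = card {t\<in>A. X t \<omega> = i} + card {t\<in>B. X t \<omega> = i}"
      using fin disj by (intro card_Un_disjoint) auto
    ultimately show ?thesis by simp
  qed
  have "{t\<in>A. restrict (\<lambda>t. X t \<omega>) (A \<union> B) t = i} = {t\<in>A. X t \<omega> = i}"
    "{t\<in>B. restrict (\<lambda>t. X t \<omega>) (A \<union> B) t = i} = {t\<in>B. X t \<omega> = i}" for i by auto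
  moreover have "restrict (\<lambda>t. X t \<omega>) (A \<union> B) \<in> (A \<union> B) \<rightarrow>\<^sub>E {1..n}" using range by auto
  ultimately show ?thesis
    unfolding good_words_def collected_def counts_ok_def AB[symmetric] A[symmetric] split
    by (simp only: mem_Collect_eq) blast
qed

context coupon_process
begin

lemma measurable_type: "1 \<le> t \<Longrightarrow> X t \<in> measurable M (count_space UNIV)"
  using indep_types by (auto simp: indep_vars_def)

lemma measurable_arrival_time: "(\<lambda>\<omega>. arrival_time X i r \<omega>) \<in> measurable M (count_space UNIV)"
  unfolding arrival_time_def
proof (rule measurable_enumerate)
  fix t
  show "Measurable.pred M (\<lambda>\<omega>. t \<in> {t. 1 \<le> t \<and> X t \<omega> = i})"
  proof (cases "1 \<le> t")
    case True
    note [measurable] = measurable_type[OF True]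
    show ?thesis by simp
  qed simp
qed

lemma measurable_completion_time:
  assumes "1 \<le> n"
  shows "completion_time n X r \<in> measurable M (count_space UNIV)"
proof -
  have "(\<lambda>\<omega>. completion_time n X r \<omega>) \<in> measurable M (count_space UNIV)"
    unfolding completion_time_def measurable_count_space_eq2_countable
  proof safe
    fix m
    note [measurable] = measurable_arrival_time
    have "(\<lambda>\<omega>. Max ((\<lambda>i. arrival_time X i r \<omega>) ` {1..n})) -` {m} \<inter> space M =
      {\<omega>\<in>space M. (\<forall>i\<in>{1..n}. arrival_time X i r \<omega> \<le> m) \<and> (\<exists>i\<in>{1..n}. arrival_time X i r \<omega> = m)}"
    proof -
      have "Max ((\<lambda>i. arrival_time X i r \<omega>) ` {1..n}) = m \<longleftrightarrow>
          (\<forall>i\<in>{1..n}. arrival_time X i r \<omega> \<le> m) \<and> (\<exists>i\<in>{1..n}. arrival_time X i r \<omega> = m)" for \<omega>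
        using assms by (subst Max_eq_iff) auto
      then show ?thesis by blast
    qed
    also have "\<dots> \<in> sets M" by measurable
    finally show "(\<lambda>\<omega>. Max ((\<lambda>i. arrival_time X i r \<omega>) ` {1..n})) -` {m} \<inter> space M \<in> sets M" .
  qed simp
  then show ?thesis by simp
qed

lemma pred_collected: "Measurable.pred M (collected n X r m)"
proof -
  have "Measurable.pred M (\<lambda>\<omega>. \<forall>i\<in>{1..n}. r < card {t\<in>{1..m}. X t \<omega> = i})"
  proof (rule pred_intros_finite(3))
    fix i
    have "(\<lambda>\<omega>. \<Sum>t\<in>{1..m}. if X t \<omega> = i then 1 else 0 :: nat) \<in> measurable M (count_space UNIV)"
    proof (rule measurable_sum_nat)
      fix t assume "t \<in> {1..m}"
      then have [measurable]: "X t \<in> measurable M (count_space UNIV)" using measurable_type by simp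
      show "(\<lambda>\<omega>. if X t \<omega> = i then 1 else 0 :: nat) \<in> measurable M (count_space UNIV)" by measurable
    qed
    moreover have "(\<Sum>t\<in>{1..m}. if X t \<omega> = i then 1 else 0 :: nat) = card {t\<in>{1..m}. X t \<omega> = i}" for \<omega>
      unfolding card_eq_sum by (rule sum.inter_filter[symmetric]) simp
    ultimately have [measurable]: "(\<lambda>\<omega>. card {t\<in>{1..m}. X t \<omega> = i}) \<in> measurable M (count_space UNIV)"
      by (simp only:)
    show "Measurable.pred M (\<lambda>\<omega>. r < card {t\<in>{1..m}. X t \<omega> = i})" by measurable
  qed simp
  then show ?thesis unfolding collected_def[abs_def] .
qed

lemma prob_type:
  assumes "1 \<le> t" "i \<in> {1..n}"
  shows "prob (X t -` {i} \<inter> space M) = 1 / real n"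
proof -
  have "prob (X t -` {i} \<inter> space M) = measure (distr M (count_space UNIV) (X t)) {i}"
    using assms by (simp add: measure_distr measurable_type)
  also have "\<dots> = 1 / real n"
    unfolding uniform_types[OF assms(1)] using assms by (simp add: measure_pmf_single pmf_of_set)
  finally show ?thesis .
qed

lemma AE_type:
  assumes "1 \<le> n" "1 \<le> t"
  shows "AE \<omega> in M. X t \<omega> \<in> {1..n}"
proof -
  have "AE x in distr M (count_space UNIV) (X t). x \<in> {1..n}"
    unfolding uniform_types[OF assms(2)] using assms by (simp add: AE_measure_pmf_iff set_pmf_of_set)
  then show ?thesis using assms by (subst (asm) AE_distr_iff) (auto simp: measurable_type)
qed

lemma prob_word:
  assumes J: "finite J" "J \<subseteq> {1..}" and f: "\<And>t. t \<in> J \<Longrightarrow> f t \<in> {1..n}"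
  shows "prob {\<omega>\<in>space M. \<forall>t\<in>J. X t \<omega> = f t} = (1 / real n) ^ card J"
proof (cases "J = {}")
  case True
  then show ?thesis by (simp add: prob_space)
next
  case False
  have "{\<omega>\<in>space M. \<forall>t\<in>J. X t \<omega> = f t} = (\<Inter>t\<in>J. X t -` {f t} \<inter> space M)"
    using False by auto
  also have "prob \<dots> = (\<Prod>t\<in>J. prob (X t -` {f t} \<inter> space M))"
    using J False by (intro indep_varsD[OF indep_types]) auto
  also have "\<dots> = (\<Prod>t\<in>J. 1 / real n)"
    using J f by (intro prod.cong refl prob_type) auto
  finally show ?thesis by simp
qed

lemma word_event:
  assumes "finite J" "J \<subseteq> {1..}"
  shows "{\<omega>\<in>space M. \<forall>t\<in>J. X t \<omega> = f t} \<in> events"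
proof -
  have "Measurable.pred M (\<lambda>\<omega>. \<forall>t\<in>J. X t \<omega> = f t)"
  proof (rule pred_intros_finite(3)[OF assms(1)])
    fix t assume "t \<in> J"
    then have [measurable]: "X t \<in> measurable M (count_space UNIV)" using assms measurable_type by auto
    show "Measurable.pred M (\<lambda>\<omega>. X t \<omega> = f t)" by measurable
  qed
  then show ?thesis by simp
qed

lemma prob_restrict_words:
  assumes J: "finite J" "J \<subseteq> {1..}" and S: "S \<subseteq> J \<rightarrow>\<^sub>E {1..n}"
  shows "{\<omega>\<in>space M. restrict (\<lambda>t. X t \<omega>) J \<in> S} \<in> events"
    and "prob {\<omega>\<in>space M. restrict (\<lambda>t. X t \<omega>) J \<in> S} = real (card S) / real n ^ card J"
proof -
  let ?E = "\<lambda>f. {\<omega>\<in>space M. \<forall>t\<in>J. X t \<omega> = f t}"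
  have finS: "finite S" using S J by (auto intro: finite_subset intro!: finite_PiE)
  have eq: "restrict (\<lambda>t. X t \<omega>) J = f \<longleftrightarrow> (\<forall>t\<in>J. X t \<omega> = f t)" if "f \<in> S" for \<omega> f
    using S that by (auto simp: restrict_def fun_eq_iff PiE_def extensional_def)
  have U: "{\<omega>\<in>space M. restrict (\<lambda>t. X t \<omega>) J \<in> S} = (\<Union>f\<in>S. ?E f)"
    by (auto simp: eq[symmetric])
  show "{\<omega>\<in>space M. restrict (\<lambda>t. X t \<omega>) J \<in> S} \<in> events"
    unfolding U by (intro sets.finite_UN finS word_event J)
  have "prob (\<Union>f\<in>S. ?E f) = (\<Sum>f\<in>S. prob (?E f))"
  proof (rule finite_measure_finite_Union[OF finS])
    show "?E ` S \<subseteq> events" using word_event[OF J] by blast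
    show "disjoint_family_on ?E S"
      unfolding disjoint_family_on_def
    proof (intro ballI impI)
      fix f g assume fg: "f \<in> S" "g \<in> S" "f \<noteq> g"
      have False if "\<omega> \<in> ?E f" "\<omega> \<in> ?E g" for \<omega>
        using eq[OF fg(1), of \<omega>] eq[OF fg(2), of \<omega>] that fg(3) by simp
      then show "?E f \<inter> ?E g = {}" by blast
    qed
  qed
  also have "\<dots> = (\<Sum>f\<in>S. (1 / real n) ^ card J)"
    using S by (intro sum.cong refl prob_word J) (auto simp: PiE_def Pi_def)
  finally show "prob {\<omega>\<in>space M. restrict (\<lambda>t. X t \<omega>) J \<in> S} = real (card S) / real n ^ card J"
    unfolding U by (simp add: power_one_over)
qed

text \<open>
  Almost surely the draws form a word over \<open>{1..n}\<close>, and all words of the same length are equally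
  likely.
\<close>

lemma prob_collected_twice:
  assumes "1 \<le> n"
  shows "prob {\<omega>\<in>space M. collected n X r\<^sub>1 a \<omega> \<and> collected n X r\<^sub>2 (a + b) \<omega>} =
    fact a * fact b * good_coeff (counts_ok r\<^sub>1 r\<^sub>2) n a b / real n ^ (a + b)"
proof -
  define A B where "A = {1..a}" and "B = {a+1..a+b}"
  define W where "W = good_words (counts_ok r\<^sub>1 r\<^sub>2) n A B"
  have AB: "finite A" "finite B" "A \<inter> B = {}" "card A = a" "card B = b"
    "finite (A \<union> B)" "A \<union> B \<subseteq> {1..}" "A \<union> B = {1..a+b}"
    by (auto simp: A_def B_def)
  have cardJ: "card (A \<union> B) = a + b" using AB by (simp add: card_Un_disjoint)
  have W: "W \<subseteq> (A \<union> B) \<rightarrow>\<^sub>E {1..n}" by (auto simp: W_def good_words_def)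
  have "AE \<omega> in M. \<forall>t\<in>A \<union> B. X t \<omega> \<in> {1..n}"
  proof (rule AE_finite_allI[OF AB(6)])
    fix t assume "t \<in> A \<union> B"
    then show "AE \<omega> in M. X t \<omega> \<in> {1..n}" using AE_type[OF assms, of t] AB(7) by auto
  qed
  then have ae: "AE \<omega> in M. \<omega> \<in> {\<omega>\<in>space M. collected n X r\<^sub>1 a \<omega> \<and> collected n X r\<^sub>2 (a + b) \<omega>} \<longleftrightarrow>
      \<omega> \<in> {\<omega>\<in>space M. restrict (\<lambda>t. X t \<omega>) (A \<union> B) \<in> W}"
  proof (rule eventually_mono)
    fix \<omega> assume *: "\<forall>t\<in>A \<union> B. X t \<omega> \<in> {1..n}"
    have "collected n X r\<^sub>1 a \<omega> \<and> collected n X r\<^sub>2 (a + b) \<omega> \<longleftrightarrow> restrict (\<lambda>t. X t \<omega>) (A \<union> B) \<in> W"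
      unfolding W_def using AB(3,8) A_def *
      by (rule collected_twice_iff_good_words[where X = X and \<omega> = \<omega> and n = n and A = A and B = B and a = a and b = b])
    then show "\<omega> \<in> {\<omega>\<in>space M. collected n X r\<^sub>1 a \<omega> \<and> collected n X r\<^sub>2 (a + b) \<omega>} \<longleftrightarrow>
      \<omega> \<in> {\<omega>\<in>space M. restrict (\<lambda>t. X t \<omega>) (A \<union> B) \<in> W}" by blast
  qed
  have "{\<omega>\<in>space M. collected n X r\<^sub>1 a \<omega> \<and> collected n X r\<^sub>2 (a + b) \<omega>} \<in> events"
    using pred_collected[of r\<^sub>1 a] pred_collected[of r\<^sub>2 "a + b"] by measurable
  then have "prob {\<omega>\<in>space M. collected n X r\<^sub>1 a \<omega> \<and> collected n X r\<^sub>2 (a + b) \<omega>} = real (card W) / real n ^ card (A \<union> B)"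
    using finite_measure_eq_AE[OF ae _ prob_restrict_words(1)[OF AB(6,7) W]]
      prob_restrict_words(2)[OF AB(6,7) W] by simp
  also have "real (card W) = fact a * fact b * good_coeff (counts_ok r\<^sub>1 r\<^sub>2) n a b"
    unfolding W_def card_good_words[OF AB(1-3)] AB(4,5) ..
  finally show ?thesis unfolding cardJ .
qed

text \<open>
  The probability of not seeing type \<open>i\<close> in \<open>m\<close> consecutive draws is \<open>(1 - 1 / n)\<^sup>m\<close>, which
  tends to \<open>0\<close>.
\<close>

lemma AE_infinitely_often:
  assumes i: "i \<in> {1..n}"
  shows "AE \<omega> in M. infinite {t. 1 \<le> t \<and> X t \<omega> = i}"
proof -
  have "AE \<omega> in M. \<exists>t>k. X t \<omega> = i" for k
  proof -
    \<comment> \<open>\<open>F m\<close>: type \<open>i\<close> does not occur among the \<open>m\<close> draws after time \<open>k\<close>.\<close>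
    define F where "F m = {\<omega>\<in>space M. \<forall>t\<in>{k<..k+m}. X t \<omega> \<noteq> i}" for m
    have Fm: "F m \<in> events" for m
    proof -
      have "Measurable.pred M (\<lambda>\<omega>. \<forall>t\<in>{k<..k+m}. X t \<omega> \<noteq> i)"
      proof (rule pred_intros_finite(3)[OF finite_greaterThanAtMost])
        fix t assume "t \<in> {k<..k+m}"
        then have [measurable]: "X t \<in> measurable M (count_space UNIV)" using measurable_type by auto
        show "Measurable.pred M (\<lambda>\<omega>. X t \<omega> \<noteq> i)" by measurable
      qed
      then show ?thesis by (simp add: F_def)
    qed
    have "prob (F m) = (1 - 1 / real n) ^ m" for m
    proof (cases "m = 0")
      case True
      then show ?thesis by (simp add: F_def prob_space)
    next
      case False
      have "F m = (\<Inter>t\<in>{k<..k+m}. X t -` (- {i}) \<inter> space M)"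
        using False by (auto simp: F_def)
      also have "prob \<dots> = (\<Prod>t\<in>{k<..k+m}. prob (X t -` (- {i}) \<inter> space M))"
        using False by (intro indep_varsD[OF indep_types]) auto
      also have "\<dots> = (\<Prod>t\<in>{k<..k+m}. 1 - 1 / real n)"
      proof (rule prod.cong[OF refl])
        fix t assume "t \<in> {k<..k+m}"
        then have t: "1 \<le> t" by auto
        have "X t -` (- {i}) \<inter> space M = space M - (X t -` {i} \<inter> space M)" by auto
        then show "prob (X t -` (- {i}) \<inter> space M) = 1 - 1 / real n"
          using prob_compl[of "X t -` {i} \<inter> space M"] measurable_sets[OF measurable_type[OF t], of "{i}"]
            prob_type[OF t i] by simp
      qed
      finally show ?thesis by simp
    qed
    moreover have "(\<lambda>m. (1 - 1 / real n) ^ m) \<longlonglongrightarrow> 0"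
      using i by (intro LIMSEQ_realpow_zero) auto
    ultimately have lim: "(\<lambda>m. prob (F m)) \<longlonglongrightarrow> 0" by simp
    have "prob (\<Inter>m. F m) \<le> 0"
      by (rule LIMSEQ_le_const[OF lim]) (auto intro!: exI[of _ 0] finite_measure_mono Fm)
    then have "prob (\<Inter>m. F m) = 0" using measure_nonneg order.antisym by blast
    moreover have "(\<Inter>m. F m) \<in> events" using Fm by auto
    ultimately have "AE \<omega> in M. \<omega> \<notin> (\<Inter>m. F m)" using prob_eq_0 by blast
    then show ?thesis
      using AE_space
    proof eventually_elim
      case (elim \<omega>)
      then show ?case by (auto simp: F_def)
    qed
  qed
  then have "AE \<omega> in M. \<forall>k. \<exists>t>k. X t \<omega> = i" by (simp add: AE_all_countable)
  then show ?thesis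
  proof eventually_elim
    case (elim \<omega>)
    show ?case unfolding infinite_nat_iff_unbounded
    proof
      fix k
      obtain t where "t > k" "X t \<omega> = i" using elim by blast
      then show "\<exists>t>k. t \<in> {t. 1 \<le> t \<and> X t \<omega> = i}" by (intro exI[of _ t]) auto
    qed
  qed
qed

text \<open>
  This holds only almost surely: on the null event that some type arrives finitely often, arrival
  times are unspecified.
\<close>

lemma AE_completion_time_le_iff:
  assumes "1 \<le> n"
  shows "AE \<omega> in M. \<forall>r m. completion_time n X r \<omega> \<le> m \<longleftrightarrow> collected n X r m \<omega>"
proof -
  have "AE \<omega> in M. \<forall>i\<in>{1..n}. infinite {t. 1 \<le> t \<and> X t \<omega> = i}"
  proof (rule AE_finite_allI)
    fix i assume "i \<in> {1..n}"
    then show "AE \<omega> in M. infinite {t. 1 \<le> t \<and> X t \<omega> = i}" by (rule AE_infinitely_often)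
  qed (rule finite_atLeastAtMost)
  then show ?thesis
  proof eventually_elim
    case (elim \<omega>)
    show ?case
    proof (intro allI)
      fix r m
      have "completion_time n X r \<omega> \<le> m \<longleftrightarrow> (\<forall>i\<in>{1..n}. arrival_time X i r \<omega> \<le> m)"
        unfolding completion_time_def using assms by (subst Max_le_iff) auto
      also have "\<dots> \<longleftrightarrow> (\<forall>i\<in>{1..n}. r < card ({t. 1 \<le> t \<and> X t \<omega> = i} \<inter> {..m}))"
        unfolding arrival_time_def
        by (intro ball_cong refl enumerate_le_iff elim[rule_format])
      also have "\<dots> \<longleftrightarrow> collected n X r m \<omega>"
      proof -
        have "{t. 1 \<le> t \<and> X t \<omega> = i} \<inter> {..m} = {t\<in>{1..m}. X t \<omega> = i}" for i by auto
        then show ?thesis unfolding collected_def by (simp only:)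
      qed
      finally show "completion_time n X r \<omega> \<le> m \<longleftrightarrow> collected n X r m \<omega>" .
    qed
  qed
qed

end

section \<open>The ratio of two asymptotically exponential variables\<close>

text \<open>
  A truncated lower Riemann-Stieltjes sum of mesh \<open>h\<close> for the integral of \<open>exp (- c s)\<close> against
  the standard exponential law, which is \<open>1 / (1 + c)\<close>. The sum is geometric; letting first \<open>K\<close>
  tend to infinity and then \<open>h\<close> to \<open>0\<close> brings it arbitrarily close to the integral.
\<close>

lemma exponential_ratio_sum:
  assumes c: "(c::real) > 0" and v: "v < 1 / (1 + c)"
  obtains h K where "h > 0"
    "v < (\<Sum>j<K. exp (- (c * (real (j + 2) * h))) * (exp (- (real (j + 1) * h)) - exp (- (real (j + 2) * h))))"
proof -
  define z where "z h = exp (- ((1 + c) * h))" for h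
  have "((\<lambda>h. (1 - exp (- h)) * exp (- (c * h)) * (z h / (1 - z h))) \<longlongrightarrow> inverse (c + 1)) (at_right 0)"
    unfolding z_def using c by real_asymp
  moreover have "v < inverse (c + 1)" using v by (simp add: inverse_eq_divide add.commute)
  ultimately have "\<forall>\<^sub>F h in at_right 0. v < (1 - exp (- h)) * exp (- (c * h)) * (z h / (1 - z h)) \<and> 0 < h"
    using order_tendstoD(1) eventually_at_right_less eventually_conj by blast
  then obtain h where h: "v < (1 - exp (- h)) * exp (- (c * h)) * (z h / (1 - z h))" "0 < h"
    using eventually_happens[of _ "at_right (0::real)"] by auto
  have z: "0 < z h" "z h < 1" using c h by (auto simp: z_def)
  have "(\<lambda>j. z h ^ j) sums (1 / (1 - z h))" using z by (intro geometric_sums) auto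
  then have "(\<lambda>j. (1 - exp (- h)) * exp (- (c * h)) * z h * z h ^ j) sums
      ((1 - exp (- h)) * exp (- (c * h)) * z h * (1 / (1 - z h)))"
    by (rule sums_mult)
  then have "(\<lambda>K. \<Sum>j<K. (1 - exp (- h)) * exp (- (c * h)) * z h * z h ^ j) \<longlonglongrightarrow>
      (1 - exp (- h)) * exp (- (c * h)) * (z h / (1 - z h))"
    by (simp add: sums_def)
  from order_tendstoD(1)[OF this h(1)] obtain K where
    K: "v < (\<Sum>j<K. (1 - exp (- h)) * exp (- (c * h)) * z h * z h ^ j)"
    by (auto simp: eventually_sequentially)
  have "(1 - exp (- h)) * exp (- (c * h)) * z h * z h ^ j =
     exp (- (c * (real (j + 2) * h))) * (exp (- (real (j + 1) * h)) - exp (- (real (j + 2) * h)))" for j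
    by (simp add: z_def algebra_simps flip: exp_add exp_of_nat_mult)
  with K h(2) that show ?thesis by simp
qed

text \<open>
  Inside the event \<open>c A \<le> B\<close> lie the disjoint events \<open>s\<^sub>j \<le> A < s\<^bsub>j+1\<^esub>\<close>, \<open>c s\<^bsub>j+1\<^esub> \<le> B\<close>
  over a grid with points \<open>s\<^sub>j > 0\<close>; their probabilities are differences of values whose limits are
  given. The grid avoids \<open>0\<close> because the joint limit is given at positive arguments.
\<close>

lemma ratio_of_exponentials_lower:
  fixes M :: "nat \<Rightarrow> 'a measure" and A B :: "nat \<Rightarrow> 'a \<Rightarrow> real"
  assumes M: "\<forall>\<^sub>F n in sequentially. prob_space (M n) \<and> A n \<in> borel_measurable (M n) \<and> B n \<in> borel_measurable (M n)"
    and lim: "\<And>s t. 0 < s \<Longrightarrow> 0 < t \<Longrightarrow>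
      (\<lambda>n. measure (M n) {\<omega>\<in>space (M n). s \<le> A n \<omega> \<and> t \<le> B n \<omega>}) \<longlonglongrightarrow> exp (- s) * exp (- t)"
    and c: "0 < c" and v: "v < 1 / (1 + c)"
  shows "\<forall>\<^sub>F n in sequentially. v < measure (M n) {\<omega>\<in>space (M n). c * A n \<omega> \<le> B n \<omega>}"
proof -
  obtain h K where h: "h > 0" and
    K: "v < (\<Sum>j<K. exp (- (c * (real (j + 2) * h))) * (exp (- (real (j + 1) * h)) - exp (- (real (j + 2) * h))))"
    using exponential_ratio_sum[OF c v] .
  define Q where "Q n s t = measure (M n) {\<omega>\<in>space (M n). s \<le> A n \<omega> \<and> t \<le> B n \<omega>}" for n s t
  define s where "s j = real (j + 1) * h" for j
  define t where "t j = c * (real (j + 2) * h)" for j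
  have pos: "s j > 0" "t j > 0" "s j < s (Suc j)" "t j = c * s (Suc j)" for j
    using h c by (auto simp: s_def t_def)
  have "(\<lambda>n. \<Sum>j<K. Q n (s j) (t j) - Q n (s (Suc j)) (t j)) \<longlonglongrightarrow>
      (\<Sum>j<K. exp (- s j) * exp (- t j) - exp (- s (Suc j)) * exp (- t j))"
    unfolding Q_def by (intro tendsto_sum tendsto_diff lim pos)
  moreover have "(\<Sum>j<K. exp (- s j) * exp (- t j) - exp (- s (Suc j)) * exp (- t j)) =
     (\<Sum>j<K. exp (- (c * (real (j + 2) * h))) * (exp (- (real (j + 1) * h)) - exp (- (real (j + 2) * h))))"
    by (intro sum.cong refl) (simp add: s_def t_def algebra_simps)
  ultimately have "\<forall>\<^sub>F n in sequentially. v < (\<Sum>j<K. Q n (s j) (t j) - Q n (s (Suc j)) (t j))"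
    using K by (intro order_tendstoD(1)) auto
  with M show ?thesis
  proof eventually_elim
    case (elim n)
    interpret prob_space "M n" using elim by simp
    have [measurable]: "A n \<in> borel_measurable (M n)" "B n \<in> borel_measurable (M n)" using elim by auto
    define D where "D j = {\<omega>\<in>space (M n). s j \<le> A n \<omega> \<and> A n \<omega> < s (Suc j) \<and> t j \<le> B n \<omega>}" for j
    have D[measurable]: "D j \<in> events" for j unfolding D_def by measurable
    have smono: "s i \<le> s j" if "i \<le> j" for i j using that h by (simp add: s_def)
    have "prob (D j) = Q n (s j) (t j) - Q n (s (Suc j)) (t j)" for j
    proof -
      have "D j = {\<omega>\<in>space (M n). s j \<le> A n \<omega> \<and> t j \<le> B n \<omega>} - {\<omega>\<in>space (M n). s (Suc j) \<le> A n \<omega> \<and> t j \<le> B n \<omega>}"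
        unfolding D_def by auto
      moreover have "{\<omega>\<in>space (M n). s (Suc j) \<le> A n \<omega> \<and> t j \<le> B n \<omega>} \<subseteq> {\<omega>\<in>space (M n). s j \<le> A n \<omega> \<and> t j \<le> B n \<omega>}"
        using smono[of j "Suc j"] by auto
      ultimately show ?thesis unfolding Q_def by (simp add: finite_measure_Diff)
    qed
    then have "(\<Sum>j<K. Q n (s j) (t j) - Q n (s (Suc j)) (t j)) = (\<Sum>j<K. prob (D j))" by simp
    also have "\<dots> = prob (\<Union>j<K. D j)"
    proof (rule finite_measure_finite_Union[symmetric])
      show "disjoint_family_on D {..<K}"
        unfolding disjoint_family_on_def
      proof (intro ballI impI)
        fix i j :: nat assume "i \<noteq> j"
        have "D i \<inter> D j = {}" if "i < j" for i j
          using smono[of "Suc i" j] that by (auto simp: D_def)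
        with \<open>i \<noteq> j\<close> show "D i \<inter> D j = {}" by (metis inf_commute linorder_neqE_nat)
      qed
    qed auto
    also have "\<dots> \<le> prob {\<omega>\<in>space (M n). c * A n \<omega> \<le> B n \<omega>}"
    proof (rule finite_measure_mono)
      show "(\<Union>j<K. D j) \<subseteq> {\<omega>\<in>space (M n). c * A n \<omega> \<le> B n \<omega>}"
      proof
        fix \<omega> assume "\<omega> \<in> (\<Union>j<K. D j)"
        then obtain j where j: "\<omega> \<in> space (M n)" "A n \<omega> < s (Suc j)" "t j \<le> B n \<omega>" by (auto simp: D_def)
        then have "c * A n \<omega> \<le> t j" using c pos(4)[of j] by simp
        with j show "\<omega> \<in> {\<omega>\<in>space (M n). c * A n \<omega> \<le> B n \<omega>}" by auto
      qed
      show "{\<omega>\<in>space (M n). c * A n \<omega> \<le> B n \<omega>} \<in> events" by measurable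
    qed
    finally show ?case using elim by linarith
  qed
qed

text \<open>
  The upper bound is the lower bound with the roles of the variables exchanged: for \<open>d > 1 / c\<close>
  the event \<open>d B \<le> A\<close> is disjoint from \<open>c A \<le> B\<close>, and its probability is asymptotically at least
  \<open>1 / (1 + d)\<close>, where \<open>1 - 1 / (1 + d)\<close> tends to \<open>1 / (1 + c)\<close> as \<open>d\<close> decreases to \<open>1 / c\<close>.
\<close>

lemma ratio_of_exponentials:
  fixes M :: "nat \<Rightarrow> 'a measure" and A B :: "nat \<Rightarrow> 'a \<Rightarrow> real"
  assumes M: "\<forall>\<^sub>F n in sequentially. prob_space (M n) \<and> A n \<in> borel_measurable (M n) \<and> B n \<in> borel_measurable (M n)"
    and pos: "\<And>n \<omega>. 0 < B n \<omega>"
    and lim: "\<And>s t. 0 < s \<Longrightarrow> 0 < t \<Longrightarrow>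
      (\<lambda>n. measure (M n) {\<omega>\<in>space (M n). s \<le> A n \<omega> \<and> t \<le> B n \<omega>}) \<longlonglongrightarrow> exp (- s) * exp (- t)"
    and c: "0 < c"
  shows "(\<lambda>n. measure (M n) {\<omega>\<in>space (M n). c * A n \<omega> \<le> B n \<omega>}) \<longlonglongrightarrow> 1 / (1 + c)"
proof (rule order_tendstoI)
  fix v assume v: "v < 1 / (1 + c)"
  show "\<forall>\<^sub>F n in sequentially. v < measure (M n) {\<omega>\<in>space (M n). c * A n \<omega> \<le> B n \<omega>}"
    by (rule ratio_of_exponentials_lower[OF M _ c v]) (rule lim)
next
  fix u assume u: "1 / (1 + c) < u"
  have "((\<lambda>d. 1 - 1 / (1 + d)) \<longlongrightarrow> 1 - 1 / (1 + 1 / c)) (at_right (1 / c))"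
    using c by (intro tendsto_intros) (auto simp: add_pos_pos less_imp_neq[symmetric])
  moreover have "1 - 1 / (1 + 1 / c) = 1 / (1 + c)" using c by (simp add: field_simps)
  ultimately have "\<forall>\<^sub>F d in at_right (1 / c). 1 - 1 / (1 + d) < u"
    using u by (intro order_tendstoD(2)) auto
  then have "\<forall>\<^sub>F d in at_right (1 / c). 1 - 1 / (1 + d) < u \<and> 1 / c < d"
    using eventually_at_right_less eventually_conj by blast
  then obtain d where d: "1 - 1 / (1 + d) < u" "1 / c < d"
    using eventually_happens[of _ "at_right (1 / c)"] by auto
  have d0: "0 < d" using d(2) c by (meson divide_pos_pos less_trans zero_less_one)
  have "\<forall>\<^sub>F n in sequentially. 1 - u < measure (M n) {\<omega>\<in>space (M n). d * B n \<omega> \<le> A n \<omega>}"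
  proof (rule ratio_of_exponentials_lower[OF _ _ d0])
    show "\<forall>\<^sub>F n in sequentially. prob_space (M n) \<and> B n \<in> borel_measurable (M n) \<and> A n \<in> borel_measurable (M n)"
      using M by eventually_elim simp
    fix s t :: real assume "0 < s" "0 < t"
    then show "(\<lambda>n. measure (M n) {\<omega>\<in>space (M n). s \<le> B n \<omega> \<and> t \<le> A n \<omega>}) \<longlonglongrightarrow> exp (- s) * exp (- t)"
      using lim[of t s] by (simp add: conj_commute mult.commute)
  qed (use d in simp)
  with M show "\<forall>\<^sub>F n in sequentially. measure (M n) {\<omega>\<in>space (M n). c * A n \<omega> \<le> B n \<omega>} < u"
  proof eventually_elim
    case (elim n)
    interpret prob_space "M n" using elim by simp
    have [measurable]: "A n \<in> borel_measurable (M n)" "B n \<in> borel_measurable (M n)" using elim by auto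
    have "B n \<omega> < c * A n \<omega>" if "d * B n \<omega> \<le> A n \<omega>" for \<omega>
    proof -
      have "1 < c * d" using d(2) c by (simp add: field_simps)
      then have "B n \<omega> < c * d * B n \<omega>" using pos[of n \<omega>] by simp
      also have "\<dots> \<le> c * A n \<omega>" using that c by (simp add: mult.assoc)
      finally show ?thesis .
    qed
    then have "{\<omega>\<in>space (M n). c * A n \<omega> \<le> B n \<omega>} \<subseteq> space (M n) - {\<omega>\<in>space (M n). d * B n \<omega> \<le> A n \<omega>}"
      by force
    then have "prob {\<omega>\<in>space (M n). c * A n \<omega> \<le> B n \<omega>} \<le> prob (space (M n) - {\<omega>\<in>space (M n). d * B n \<omega> \<le> A n \<omega>})"
      by (rule finite_measure_mono) measurable
    also have "\<dots> = 1 - prob {\<omega>\<in>space (M n). d * B n \<omega> \<le> A n \<omega>}"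
      by (rule prob_compl) measurable
    finally show ?case using elim by linarith
  qed
qed

section \<open>The limit of the completion gap\<close>

lemma nat_floor_bounds:
  assumes "0 \<le> (x::real)"
  shows "real (nat \<lfloor>x\<rfloor>) \<le> x" "x < real (nat \<lfloor>x\<rfloor>) + 1"
  using assms by linarith+

lemma le_nat_floor_real_iff: "0 \<le> (x::real) \<Longrightarrow> k \<le> nat \<lfloor>x\<rfloor> \<longleftrightarrow> real k \<le> x"
  by (simp add: le_nat_iff le_floor_iff)

text \<open>
  Poissonization and its removal, applied to the probability that both collectors have completed.
\<close>

lemma collected_pair_limit:
  fixes M :: "nat \<Rightarrow> 'a measure" and X :: "nat \<Rightarrow> nat \<Rightarrow> 'a \<Rightarrow> nat"
  assumes proc: "\<And>n. 1 \<le> n \<Longrightarrow> coupon_process (M n) n (X n)" and r: "r\<^sub>1 < r\<^sub>2"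
    and a: "\<forall>\<^sub>F n in sequentially. real (a n) \<le> real n * threshold r\<^sub>1 x n \<and> real n * threshold r\<^sub>1 x n < real (a n) + 1"
    and m: "\<forall>\<^sub>F n in sequentially. real (m n) \<le> real n * threshold r\<^sub>2 y n \<and> real n * threshold r\<^sub>2 y n < real (m n) + 1"
  shows "(\<lambda>n. measure (M n) {\<omega>\<in>space (M n). collected n (X n) r\<^sub>1 (a n) \<omega> \<and> collected n (X n) r\<^sub>2 (m n) \<omega>})
    \<longlonglongrightarrow> exp (- (exp (- x) / fact r\<^sub>1 + exp (- y) / fact r\<^sub>2))"
proof -
  define q where "q n i j = measure (M n) {\<omega>\<in>space (M n). collected n (X n) r\<^sub>1 i \<omega> \<and> collected n (X n) r\<^sub>2 (i + j) \<omega>}" for n i j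
  have "\<forall>\<^sub>F n in sequentially. 0 < threshold r\<^sub>2 y n - threshold r\<^sub>1 x n"
    using filterlim_at_top_dense[THEN iffD1, OF threshold_gap_at_top[OF r], rule_format] .
  then have le: "\<forall>\<^sub>F n in sequentially. a n \<le> m n"
    using a m
  proof eventually_elim
    case (elim n)
    then have "real n * threshold r\<^sub>1 x n \<le> real n * threshold r\<^sub>2 y n" by (intro mult_left_mono) auto
    then have "real (a n) < real (m n) + 1" using elim by linarith
    then show ?case by linarith
  qed
  have "(\<lambda>n. q n (a n) (m n - a n)) \<longlonglongrightarrow> exp (- (exp (- x) / fact r\<^sub>1 + exp (- y) / fact r\<^sub>2))"
  proof (rule depoissonization[OF r _ _ _ _ a])
    fix n i j :: nat assume "1 \<le> n"
    then interpret coupon_process "M n" n "X n" by (rule proc)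
    show "0 \<le> q n i j" "q n i j \<le> 1" by (simp_all add: q_def)
  next
    fix n i i' j j' :: nat assume n: "1 \<le> n" and le: "i \<le> i'" "j \<le> j'"
    then interpret coupon_process "M n" n "X n" by (intro proc)
    note [measurable] = pred_collected
    show "q n i j \<le> q n i' j'"
      unfolding q_def
    proof (rule finite_measure_mono)
      have "i + j \<le> i' + j'" using le by simp
      then show "{\<omega>\<in>space (M n). collected n (X n) r\<^sub>1 i \<omega> \<and> collected n (X n) r\<^sub>2 (i + j) \<omega>} \<subseteq>
        {\<omega>\<in>space (M n). collected n (X n) r\<^sub>1 i' \<omega> \<and> collected n (X n) r\<^sub>2 (i' + j') \<omega>}"
        using collected_mono[OF _ le(1)] collected_mono[of n "X n" r\<^sub>2 "i + j" _ "i' + j'"] by auto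
      show "{\<omega>\<in>space (M n). collected n (X n) r\<^sub>1 i' \<omega> \<and> collected n (X n) r\<^sub>2 (i' + j') \<omega>} \<in> events"
        by measurable
    qed
  next
    fix n :: nat and \<alpha> \<beta> :: real assume n: "1 \<le> n" and pos: "0 < \<alpha>" "0 < \<beta>"
    then interpret coupon_process "M n" n "X n" by (intro proc)
    show "(\<integral>\<^sup>+i. \<integral>\<^sup>+j. ennreal (q n i j) \<partial>poisson_pmf (real n * \<beta>) \<partial>poisson_pmf (real n * \<alpha>)) =
      ennreal (measure_pmf.prob (pair_pmf (poisson_pmf \<alpha>) (poisson_pmf \<beta>)) {(a, b). counts_ok r\<^sub>1 r\<^sub>2 a b} ^ n)"
      unfolding q_def prob_collected_twice[OF n] by (rule poissonization[OF pos n])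
  next
    show "\<forall>\<^sub>F n in sequentially. real (a n) + real (m n - a n) \<le> real n * threshold r\<^sub>2 y n \<and>
      real n * threshold r\<^sub>2 y n < real (a n) + real (m n - a n) + 1"
      using le m by eventually_elim auto
  qed
  then show ?thesis
  proof (rule Lim_transform_eventually)
    show "\<forall>\<^sub>F n in sequentially. q n (a n) (m n - a n) =
        measure (M n) {\<omega>\<in>space (M n). collected n (X n) r\<^sub>1 (a n) \<omega> \<and> collected n (X n) r\<^sub>2 (m n) \<omega>}"
      using le by eventually_elim (simp add: q_def)
  qed
qed

text \<open>
  A decreasing transform of the completion time that takes the Gumbel limit law
  \<open>exp (- exp (- x) / r!)\<close> to the standard exponential law.
\<close>

definition exp_score :: "nat \<Rightarrow> (nat \<Rightarrow> 'a \<Rightarrow> nat) \<Rightarrow> nat \<Rightarrow> 'a \<Rightarrow> real" where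
  "exp_score n X r \<omega> = exp (threshold r 0 n - real (completion_time n X r \<omega>) / real n) / fact r"

lemma exp_score_ge_iff:
  assumes "1 \<le> n" "0 < s"
  shows "s \<le> exp_score n X r \<omega> \<longleftrightarrow>
    real (completion_time n X r \<omega>) \<le> real n * threshold r (- ln (fact r * s)) n"
proof -
  let ?T = "real (completion_time n X r \<omega>)"
  have "s \<le> exp_score n X r \<omega> \<longleftrightarrow> fact r * s \<le> exp (threshold r 0 n - ?T / real n)"
    by (simp add: exp_score_def pos_le_divide_eq mult.commute)
  also have "\<dots> \<longleftrightarrow> ln (fact r * s) \<le> threshold r 0 n - ?T / real n"
    using assms exp_le_cancel_iff[of "ln (fact r * s)" "threshold r 0 n - ?T / real n"] by simp
  also have "\<dots> \<longleftrightarrow> ?T / real n \<le> threshold r (- ln (fact r * s)) n"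
    by (auto simp: threshold_def)
  also have "\<dots> \<longleftrightarrow> ?T \<le> real n * threshold r (- ln (fact r * s)) n"
    using assms by (simp add: pos_divide_le_eq mult.commute)
  finally show ?thesis .
qed

text \<open>
  With \<open>x = - ln (r\<^sub>1! s)\<close> and \<open>y = - ln (r\<^sub>2! t)\<close> the two parts of the exponent in the limit
  law become \<open>s\<close> and \<open>t\<close>.
\<close>

lemma exp_scores_limit:
  fixes M :: "nat \<Rightarrow> 'a measure" and X :: "nat \<Rightarrow> nat \<Rightarrow> 'a \<Rightarrow> nat"
  assumes proc: "\<And>n. 1 \<le> n \<Longrightarrow> coupon_process (M n) n (X n)" and r: "r\<^sub>1 < r\<^sub>2"
    and st: "0 < s" "0 < t"
  shows "(\<lambda>n. measure (M n) {\<omega>\<in>space (M n). s \<le> exp_score n (X n) r\<^sub>1 \<omega> \<and> t \<le> exp_score n (X n) r\<^sub>2 \<omega>})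
    \<longlonglongrightarrow> exp (- s) * exp (- t)"
proof -
  define x y where "x = - ln (fact r\<^sub>1 * s)" and "y = - ln (fact r\<^sub>2 * t)"
  define a m where "a n = nat \<lfloor>real n * threshold r\<^sub>1 x n\<rfloor>" and "m n = nat \<lfloor>real n * threshold r\<^sub>2 y n\<rfloor>" for n
  have pos: "\<forall>\<^sub>F n in sequentially. 0 \<le> real n * threshold r z n" for r z
    using filterlim_at_top_dense[THEN iffD1, OF threshold_at_top[of r z], rule_format, of 0]
    by eventually_elim simp
  have "(\<lambda>n. measure (M n) {\<omega>\<in>space (M n). collected n (X n) r\<^sub>1 (a n) \<omega> \<and> collected n (X n) r\<^sub>2 (m n) \<omega>})
    \<longlonglongrightarrow> exp (- (exp (- x) / fact r\<^sub>1 + exp (- y) / fact r\<^sub>2))"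
  proof (rule collected_pair_limit[OF proc r])
    show "\<forall>\<^sub>F n in sequentially. real (a n) \<le> real n * threshold r\<^sub>1 x n \<and> real n * threshold r\<^sub>1 x n < real (a n) + 1"
      using pos[of r\<^sub>1 x] by eventually_elim (simp add: a_def nat_floor_bounds)
    show "\<forall>\<^sub>F n in sequentially. real (m n) \<le> real n * threshold r\<^sub>2 y n \<and> real n * threshold r\<^sub>2 y n < real (m n) + 1"
      using pos[of r\<^sub>2 y] by eventually_elim (simp add: m_def nat_floor_bounds)
  qed
  moreover have "exp (- (exp (- x) / fact r\<^sub>1 + exp (- y) / fact r\<^sub>2)) = exp (- s) * exp (- t)"
    using st by (simp add: x_def y_def flip: exp_add)
  ultimately have lim: "(\<lambda>n. measure (M n) {\<omega>\<in>space (M n). collected n (X n) r\<^sub>1 (a n) \<omega> \<and> collected n (X n) r\<^sub>2 (m n) \<omega>})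
    \<longlonglongrightarrow> exp (- s) * exp (- t)" by simp
  show ?thesis
  proof (rule Lim_transform_eventually[OF lim])
    show "\<forall>\<^sub>F n in sequentially. measure (M n) {\<omega>\<in>space (M n). collected n (X n) r\<^sub>1 (a n) \<omega> \<and> collected n (X n) r\<^sub>2 (m n) \<omega>} =
      measure (M n) {\<omega>\<in>space (M n). s \<le> exp_score n (X n) r\<^sub>1 \<omega> \<and> t \<le> exp_score n (X n) r\<^sub>2 \<omega>}"
      using pos[of r\<^sub>1 x] pos[of r\<^sub>2 y] eventually_ge_at_top[of "1::nat"]
    proof eventually_elim
      case (elim n)
      interpret coupon_process "M n" n "X n" using elim by (intro proc)
      note [measurable] = pred_collected measurable_completion_time[OF elim(3)]
      have iff: "s \<le> exp_score n (X n) r\<^sub>1 \<omega> \<longleftrightarrow> completion_time n (X n) r\<^sub>1 \<omega> \<le> a n"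
        "t \<le> exp_score n (X n) r\<^sub>2 \<omega> \<longleftrightarrow> completion_time n (X n) r\<^sub>2 \<omega> \<le> m n" for \<omega>
        unfolding exp_score_ge_iff[OF elim(3) st(1)] exp_score_ge_iff[OF elim(3) st(2)]
        unfolding x_def[symmetric] y_def[symmetric] a_def m_def
        using elim(1,2) by (simp_all add: le_nat_floor_real_iff)
      show ?case
        unfolding iff
      proof (rule finite_measure_eq_AE)
        show "AE \<omega> in M n. \<omega> \<in> {\<omega>\<in>space (M n). collected n (X n) r\<^sub>1 (a n) \<omega> \<and> collected n (X n) r\<^sub>2 (m n) \<omega>} \<longleftrightarrow>
          \<omega> \<in> {\<omega>\<in>space (M n). completion_time n (X n) r\<^sub>1 \<omega> \<le> a n \<and> completion_time n (X n) r\<^sub>2 \<omega> \<le> m n}"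
          using AE_completion_time_le_iff[OF elim(3)] by (rule eventually_mono) blast
      qed measurable
    qed
  qed
qed

text \<open>
  The terms \<open>ln n\<close> of the two centrings cancel in the difference, which leaves the centring
  \<open>(r\<^sub>2 - r\<^sub>1) ln ln n\<close> of the gap.
\<close>

lemma completion_gap_le_iff:
  assumes "1 \<le> n"
  shows "completion_gap n X r\<^sub>1 r\<^sub>2 \<omega> / real n - (real r\<^sub>2 - real r\<^sub>1) * ln (ln (real n)) \<le> z \<longleftrightarrow>
    fact r\<^sub>1 / fact r\<^sub>2 * exp (- z) * exp_score n X r\<^sub>1 \<omega> \<le> exp_score n X r\<^sub>2 \<omega>"
proof -
  define e where "e r = threshold r 0 n - real (completion_time n X r \<omega>) / real n" for r
  have "fact r\<^sub>1 / fact r\<^sub>2 * exp (- z) * exp_score n X r\<^sub>1 \<omega> = exp (e r\<^sub>1 - z) / fact r\<^sub>2"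
  proof -
    have "exp (e r\<^sub>1 - z) = exp (- z) * exp (e r\<^sub>1)" by (simp flip: exp_add)
    then show ?thesis unfolding exp_score_def e_def[symmetric] by simp
  qed
  moreover have "exp_score n X r\<^sub>2 \<omega> = exp (e r\<^sub>2) / fact r\<^sub>2"
    unfolding exp_score_def e_def ..
  ultimately have "fact r\<^sub>1 / fact r\<^sub>2 * exp (- z) * exp_score n X r\<^sub>1 \<omega> \<le> exp_score n X r\<^sub>2 \<omega> \<longleftrightarrow> e r\<^sub>1 - z \<le> e r\<^sub>2"
    by (simp only: divide_le_cancel) simp
  also have "\<dots> \<longleftrightarrow> completion_gap n X r\<^sub>1 r\<^sub>2 \<omega> / real n - (real r\<^sub>2 - real r\<^sub>1) * ln (ln (real n)) \<le> z"
  proof -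
    have "e r\<^sub>2 - e r\<^sub>1 = (real r\<^sub>2 - real r\<^sub>1) * ln (ln (real n)) - completion_gap n X r\<^sub>1 r\<^sub>2 \<omega> / real n"
      by (simp add: e_def completion_gap_def threshold_def diff_divide_distrib left_diff_distrib)
    then show ?thesis by linarith
  qed
  finally show ?thesis by (rule sym)
qed

text \<open>
  The hypothesis concerns the strict inequality, while \<^const>\<open>cdf\<close> is defined by the weak one.
  Continuity of the given function makes both agree.
\<close>

lemma (in prob_space) cdf_logistic:
  fixes L :: "'a \<Rightarrow> real" and p q :: real
  assumes L: "L \<in> borel_measurable M" and pq: "0 < p" "0 < q"
    and lt: "\<And>x. prob {\<omega>\<in>space M. L \<omega> < x} = p / (p + q * exp (- x))"
  shows "cdf (distr M borel L) x = p / (p + q * exp (- x))"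
proof (rule antisym)
  note [measurable] = L
  have cdf: "cdf (distr M borel L) x = prob {\<omega>\<in>space M. L \<omega> \<le> x}"
  proof -
    have "L -` {..x} \<inter> space M = {\<omega>\<in>space M. L \<omega> \<le> x}" by blast
    then show ?thesis unfolding cdf_def by (simp add: measure_distr)
  qed
  have "prob {\<omega>\<in>space M. L \<omega> < x} \<le> prob {\<omega>\<in>space M. L \<omega> \<le> x}"
    by (rule finite_measure_mono) auto
  then show "p / (p + q * exp (- x)) \<le> cdf (distr M borel L) x" unfolding cdf lt .
  have le: "prob {\<omega>\<in>space M. L \<omega> \<le> x} \<le> p / (p + q * exp (- y))" if "x < y" for y
    unfolding lt[symmetric] using that by (intro finite_measure_mono) auto
  have "p + q * exp (- x) > 0" using pq by (simp add: add_pos_pos)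
  then have "((\<lambda>y. p / (p + q * exp (- y))) \<longlongrightarrow> p / (p + q * exp (- x))) (at_right x)"
    by (intro tendsto_intros) auto
  moreover have "\<forall>\<^sub>F y in at_right x. prob {\<omega>\<in>space M. L \<omega> \<le> x} \<le> p / (p + q * exp (- y))"
    using eventually_at_right_less[of x] by eventually_elim (rule le)
  ultimately show "cdf (distr M borel L) x \<le> p / (p + q * exp (- x))"
    unfolding cdf by (rule tendsto_lowerbound) simp
qed

theorem corollary2p1:
  fixes M :: "nat \<Rightarrow> 'a measure" and X :: "nat \<Rightarrow> nat \<Rightarrow> 'a \<Rightarrow> nat"
    and N :: "'b measure" and L :: "'b \<Rightarrow> real"
    and r\<^sub>1 r\<^sub>2 :: nat
  assumes "\<And>n. 1 \<le> n \<Longrightarrow> coupon_process (M n) n (X n)"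
    and "r\<^sub>1 < r\<^sub>2"
    and "prob_space N"
    and "L \<in> borel_measurable N"
    and "\<And>x::real. \<P>(\<omega> in N. L \<omega> < x) = fact r\<^sub>2 / (fact r\<^sub>2 + fact r\<^sub>1 * exp (- x))"
  shows "weak_conv_m
    (\<lambda>n. distr (M n) borel
      (\<lambda>\<omega>. completion_gap n (X n) r\<^sub>1 r\<^sub>2 \<omega> / real n - (real r\<^sub>2 - real r\<^sub>1) * ln (ln (real n))))
    (distr N borel L)"
  unfolding weak_conv_m_def weak_conv_def
proof (intro allI impI)
  fix z :: real
  define c where "c = fact r\<^sub>1 / fact r\<^sub>2 * exp (- z)"
  have meas: "completion_time n (X n) r \<in> measurable (M n) (count_space UNIV)" if "1 \<le> n" for n r
    using coupon_process.measurable_completion_time[OF assms(1)[OF that] that] .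
  have score_meas: "exp_score n (X n) r \<in> borel_measurable (M n)" if "1 \<le> n" for n r
  proof -
    note [measurable] = meas[OF that, of r]
    show ?thesis unfolding exp_score_def[abs_def] by measurable
  qed
  have c: "c > 0" by (simp add: c_def)
  have "(\<lambda>n. measure (M n) {\<omega>\<in>space (M n). c * exp_score n (X n) r\<^sub>1 \<omega> \<le> exp_score n (X n) r\<^sub>2 \<omega>}) \<longlonglongrightarrow> 1 / (1 + c)"
  proof (rule ratio_of_exponentials[OF _ _ _ c])
    show "\<forall>\<^sub>F n in sequentially. prob_space (M n) \<and> exp_score n (X n) r\<^sub>1 \<in> borel_measurable (M n) \<and>
        exp_score n (X n) r\<^sub>2 \<in> borel_measurable (M n)"
      using eventually_ge_at_top[of "1::nat"]
      by eventually_elim (auto intro: score_meas coupon_process.axioms(1)[OF assms(1)])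
    show "0 < exp_score n (X n) r\<^sub>2 \<omega>" for n \<omega> by (simp add: exp_score_def)
  qed (rule exp_scores_limit[OF assms(1,2)])
  moreover have "1 / (1 + c) = cdf (distr N borel L) z"
    unfolding prob_space.cdf_logistic[OF assms(3,4) fact_gt_zero fact_gt_zero assms(5)]
    by (simp add: c_def field_simps)
  moreover have "\<forall>\<^sub>F n in sequentially.
      measure (M n) {\<omega>\<in>space (M n). c * exp_score n (X n) r\<^sub>1 \<omega> \<le> exp_score n (X n) r\<^sub>2 \<omega>} =
      cdf (distr (M n) borel
        (\<lambda>\<omega>. completion_gap n (X n) r\<^sub>1 r\<^sub>2 \<omega> / real n - (real r\<^sub>2 - real r\<^sub>1) * ln (ln (real n)))) z"
    using eventually_ge_at_top[of "1::nat"]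
  proof eventually_elim
    case (elim n)
    note [measurable] = meas[OF elim]
    define G where "G \<omega> = completion_gap n (X n) r\<^sub>1 r\<^sub>2 \<omega> / real n - (real r\<^sub>2 - real r\<^sub>1) * ln (ln (real n))" for \<omega>
    have "G \<in> borel_measurable (M n)"
      unfolding G_def[abs_def] completion_gap_def by measurable
    then have "cdf (distr (M n) borel G) z = measure (M n) (G -` {..z} \<inter> space (M n))"
      unfolding cdf_def by (simp add: measure_distr)
    also have "G -` {..z} \<inter> space (M n) = {\<omega>\<in>space (M n). c * exp_score n (X n) r\<^sub>1 \<omega> \<le> exp_score n (X n) r\<^sub>2 \<omega>}"
      unfolding c_def completion_gap_le_iff[OF elim, symmetric] G_def by blast
    finally show ?case unfolding G_def[abs_def] by (rule sym)
  qed
  ultimately show "(\<lambda>n. cdf (distr (M n) borel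
      (\<lambda>\<omega>. completion_gap n (X n) r\<^sub>1 r\<^sub>2 \<omega> / real n - (real r\<^sub>2 - real r\<^sub>1) * ln (ln (real n)))) z)
    \<longlonglongrightarrow> cdf (distr N borel L) z"
    using Lim_transform_eventually by fastforce
qed

end
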